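(* Let $R$ be a (commutative) principal ideal domain, $\sigma\in\mathrm{Aut}(R)$, $0\ne a\in R$, and $A=R(\sigma,a)$ the corresponding generalized Weyl algebra. Assume that all $\mathcal G$-orbits in $\mathrm{Irr}(R)$ are infinite. Then all $A$-modules which are free of rank $1$ over $R$ have finite length as $A$-modules, and this length is uniformly bounded above by $$1+\left(\frac{\deg(a)}{2}\right)^2,$$ where $\deg(a)$ is the number of irreducible factors of $a$, counted with multiplicity.
   Context: Modules are left and unital. The generalized Weyl algebra $R(\sigma,a)$ is the ring generated by $R$, $x$, $y$ subject to $x\sigma(r)=rx$, $yr=\sigma(r)y$ for all $r\in R$, $xy=a$, $yx=\sigma(a)$. $\mathrm{Irr}(R)$ is the set of classes, up to associates, of irreducible elements of $R$; $\mathcal G=\langle\sigma\rangle\le\mathrm{Aut}(R)$ acts on it by $\sigma\cdot[r]=[\sigma(r)]$. *)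

theory Defs
  imports "HOL-Algebra.Algebra" "HOL-Library.Extended_Nat"
begin

section \<open>Ring automorphisms and orbits of irreducible elements\<close>

text \<open>As for the library's \<^const>\<open>auto\<close>, automorphisms are extensional on the carrier, so that
  distinct elements of the automorphism group are distinct maps.\<close>

definition ring_auto :: "('r, 'x) ring_scheme \<Rightarrow> ('r \<Rightarrow> 'r) set"
  where "ring_auto R = ring_hom R R \<inter> Bij (carrier R)"

definition RingAutoGroup :: "('r, 'x) ring_scheme \<Rightarrow> ('r \<Rightarrow> 'r) monoid"
  where "RingAutoGroup R = BijGroup (carrier R) \<lparr>carrier := ring_auto R\<rparr>"

definition assoc_class :: "('r, 'x) ring_scheme \<Rightarrow> 'r \<Rightarrow> 'r set"
  where "assoc_class R r = {s \<in> carrier R. s \<sim>\<^bsub>R\<^esub> r}"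

definition Irr :: "('r, 'x) ring_scheme \<Rightarrow> 'r set set"
  where "Irr R = {assoc_class R r | r. r \<in> carrier R \<and> ring_irreducible\<^bsub>R\<^esub> r}"

text \<open>The action of automorphisms on \<^term>\<open>Irr R\<close> is given by taking images;
  by \<open>image_assoc_class\<close> below, this maps the class of \<open>r\<close> to the class of \<open>\<tau> r\<close>.\<close>

definition Irr_action :: "('r \<Rightarrow> 'r) \<Rightarrow> 'r set \<Rightarrow> 'r set"
  where "Irr_action \<tau> C = \<tau> ` C"

definition Irr_orbits :: "('r, 'x) ring_scheme \<Rightarrow> ('r \<Rightarrow> 'r) \<Rightarrow> 'r set set set"
  where "Irr_orbits R \<sigma> = orbits (subgroup_generated (RingAutoGroup R) {\<sigma>}) (Irr R) Irr_action"

lemma (in ring) subgroup_ring_auto: "subgroup (ring_auto R) (BijGroup (carrier R))"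
proof (rule subgroup.intro)
  show "ring_auto R \<subseteq> carrier (BijGroup (carrier R))"
    by (auto simp: ring_auto_def BijGroup_def)
next
  fix f g assume "f \<in> ring_auto R" "g \<in> ring_auto R"
  then show "f \<otimes>\<^bsub>BijGroup (carrier R)\<^esub> g \<in> ring_auto R"
    by (auto simp: BijGroup_def ring_auto_def compose_Bij intro!: ring_hom_memI
        simp: compose_eq ring_hom_closed ring_hom_mult ring_hom_add ring_hom_one)
next
  show "\<one>\<^bsub>BijGroup (carrier R)\<^esub> \<in> ring_auto R"
    by (auto simp: BijGroup_def ring_auto_def id_Bij intro!: ring_hom_memI)
next
  fix f assume f: "f \<in> ring_auto R"
  have b: "f \<in> Bij (carrier R)" and h: "f \<in> ring_hom R R"
    using f by (auto simp: ring_auto_def)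
  let ?g = "inv_into (carrier R) f"
  have "?g \<one> = \<one>"
    using b h by (metis Bij_def IntD2 bij_betw_def inv_into_f_f mem_Collect_eq one_closed ring_hom_one)
  moreover have "?g (x \<otimes> y) = ?g x \<otimes> ?g y" if "x \<in> carrier R" "y \<in> carrier R" for x y
    by (rule Bij_inv_into_lemma[OF _ b]) (use that h in \<open>auto simp: ring_hom_mult\<close>)
  moreover have "?g (x \<oplus> y) = ?g x \<oplus> ?g y" if "x \<in> carrier R" "y \<in> carrier R" for x y
    by (rule Bij_inv_into_lemma[OF _ b]) (use that h in \<open>auto simp: ring_hom_add\<close>)
  ultimately have "restrict ?g (carrier R) \<in> ring_hom R R"
    using b by (intro ring_hom_memI) (auto simp: Bij_inv_into_mem)
  then show "inv\<^bsub>BijGroup (carrier R)\<^esub> f \<in> ring_auto R"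
    using b by (simp add: inv_BijGroup ring_auto_def restrict_inv_into_Bij)
qed

lemma (in ring) group_RingAutoGroup: "group (RingAutoGroup R)"
  by (simp add: RingAutoGroup_def group.subgroup_imp_group group_BijGroup subgroup_ring_auto)

lemma (in ring) ring_auto_divides:
  assumes "\<tau> \<in> ring_auto R" "r \<in> carrier R" "s \<in> carrier R"
  shows "\<tau> r divides \<tau> s \<longleftrightarrow> r divides s"
proof -
  have b: "bij_betw \<tau> (carrier R) (carrier R)" and h: "\<tau> \<in> ring_hom R R"
    using assms(1) by (auto simp: ring_auto_def Bij_def)
  show ?thesis
  proof
    assume "\<tau> r divides \<tau> s"
    then obtain c where c: "c \<in> carrier R" "\<tau> s = \<tau> r \<otimes> c"
      by (auto simp: factor_def)
    obtain d where d: "d \<in> carrier R" "c = \<tau> d"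
      using b c(1) by (metis bij_betw_def imageE)
    have "\<tau> s = \<tau> (r \<otimes> d)"
      using c d h assms by (simp add: ring_hom_mult)
    then have "s = r \<otimes> d"
      using b assms d by (meson bij_betw_def inj_onD m_closed)
    then show "r divides s"
      using d by (auto simp: factor_def)
  next
    assume "r divides s"
    then show "\<tau> r divides \<tau> s"
      using h assms by (auto simp: factor_def ring_hom_mult ring_hom_closed)
  qed
qed

lemma (in ring) image_assoc_class:
  assumes "\<tau> \<in> ring_auto R" "r \<in> carrier R"
  shows "Irr_action \<tau> (assoc_class R r) = assoc_class R (\<tau> r)"
proof -
  have b: "\<tau> ` carrier R = carrier R"
    using assms(1) by (auto simp: ring_auto_def Bij_def bij_betw_def)
  have "s \<sim> r \<longleftrightarrow> \<tau> s \<sim> \<tau> r" if "s \<in> carrier R" for s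
    using that assms ring_auto_divides by (simp add: associated_def)
  then have "\<tau> ` {s \<in> carrier R. s \<sim> r} = {t \<in> \<tau> ` carrier R. t \<sim> \<tau> r}"
    by auto
  then show ?thesis
    by (simp add: Irr_action_def assoc_class_def b)
qed


section \<open>Left modules, free modules and length\<close>

text \<open>The library's \<^locale>\<open>module\<close> requires a commutative ring of scalars; the axioms here are
  the same ones over an arbitrary ring.\<close>

locale left_module = A?: ring A + M?: abelian_group M
  for A :: "('a, 'x) ring_scheme" (structure) and M :: "('a, 'm) module" (structure) +
  assumes smult_closed: "\<lbrakk>a \<in> carrier A; x \<in> carrier M\<rbrakk> \<Longrightarrow> a \<odot>\<^bsub>M\<^esub> x \<in> carrier M"
    and smult_l_distr: "\<lbrakk>a \<in> carrier A; b \<in> carrier A; x \<in> carrier M\<rbrakk>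
      \<Longrightarrow> (a \<oplus> b) \<odot>\<^bsub>M\<^esub> x = a \<odot>\<^bsub>M\<^esub> x \<oplus>\<^bsub>M\<^esub> b \<odot>\<^bsub>M\<^esub> x"
    and smult_r_distr: "\<lbrakk>a \<in> carrier A; x \<in> carrier M; y \<in> carrier M\<rbrakk>
      \<Longrightarrow> a \<odot>\<^bsub>M\<^esub> (x \<oplus>\<^bsub>M\<^esub> y) = a \<odot>\<^bsub>M\<^esub> x \<oplus>\<^bsub>M\<^esub> a \<odot>\<^bsub>M\<^esub> y"
    and smult_assoc: "\<lbrakk>a \<in> carrier A; b \<in> carrier A; x \<in> carrier M\<rbrakk>
      \<Longrightarrow> (a \<otimes> b) \<odot>\<^bsub>M\<^esub> x = a \<odot>\<^bsub>M\<^esub> (b \<odot>\<^bsub>M\<^esub> x)"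
    and smult_one: "x \<in> carrier M \<Longrightarrow> \<one> \<odot>\<^bsub>M\<^esub> x = x"

definition restrict_scalars :: "('r \<Rightarrow> 'a) \<Rightarrow> ('a, 'm) module \<Rightarrow> ('r, 'm) module"
  where "restrict_scalars \<phi> M =
    \<lparr>carrier = carrier M, monoid.mult = monoid.mult M, one = one M,
     ring.zero = ring.zero M, ring.add = ring.add M,
     smult = (\<lambda>r m. \<phi> r \<odot>\<^bsub>M\<^esub> m)\<rparr>"

definition free_of_rank :: "('r, 'x) ring_scheme \<Rightarrow> ('r, 'm) module \<Rightarrow> nat \<Rightarrow> bool"
  where "free_of_rank R M n \<longleftrightarrow>
    (\<exists>B \<subseteq> carrier M. finite B \<and> card B = n \<and>
      (\<forall>m \<in> carrier M. \<exists>!c. c \<in> B \<rightarrow>\<^sub>E carrier R \<and> m = (\<Oplus>\<^bsub>M\<^esub>b\<in>B. c b \<odot>\<^bsub>M\<^esub> b)))"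

text \<open>The length is the supremum of the lengths of all strict chains
  \<open>N 0 \<subset> N 1 \<subset> \<dots> \<subset> N n\<close> of submodules.\<close>

definition module_length :: "('a, 'x) ring_scheme \<Rightarrow> ('a, 'm) module \<Rightarrow> enat"
  where "module_length A M =
    Sup {enat n | n. \<exists>N. (\<forall>i\<le>n. submodule (N i) A M) \<and> (\<forall>i<n. N i \<subset> N (Suc i))}"

definition finite_length :: "('a, 'x) ring_scheme \<Rightarrow> ('a, 'm) module \<Rightarrow> bool"
  where "finite_length A M \<longleftrightarrow> module_length A M < \<infinity>"


section \<open>Generalized Weyl algebras\<close>

text \<open>The ring generated by \<open>R\<close>, \<open>x\<close>, \<open>y\<close> subject to the given relations is realised as the set
  of well-formed ring expressions in these generators modulo the smallest congruence that contains the ring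
  axioms, the operations of \<open>R\<close>, and the defining relations. The unit and zero are those of \<open>R\<close>.\<close>

datatype 'r gwa_term =
    Coef 'r
  | GenX
  | GenY
  | Plus "'r gwa_term" "'r gwa_term"
  | Times "'r gwa_term" "'r gwa_term"
  | Neg "'r gwa_term"

primrec gwa_wf :: "('r, 'x) ring_scheme \<Rightarrow> 'r gwa_term \<Rightarrow> bool" where
  "gwa_wf R (Coef r) \<longleftrightarrow> r \<in> carrier R"
| "gwa_wf R GenX \<longleftrightarrow> True"
| "gwa_wf R GenY \<longleftrightarrow> True"
| "gwa_wf R (Plus s t) \<longleftrightarrow> gwa_wf R s \<and> gwa_wf R t"
| "gwa_wf R (Times s t) \<longleftrightarrow> gwa_wf R s \<and> gwa_wf R t"
| "gwa_wf R (Neg t) \<longleftrightarrow> gwa_wf R t"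

inductive gwa_cong ::
    "('r, 'x) ring_scheme \<Rightarrow> ('r \<Rightarrow> 'r) \<Rightarrow> 'r \<Rightarrow> 'r gwa_term \<Rightarrow> 'r gwa_term \<Rightarrow> bool"
  for R (structure) and \<sigma> and a where
  refl: "gwa_wf R s \<Longrightarrow> gwa_cong R \<sigma> a s s"
| sym: "gwa_cong R \<sigma> a s t \<Longrightarrow> gwa_cong R \<sigma> a t s"
| trans: "gwa_cong R \<sigma> a s t \<Longrightarrow> gwa_cong R \<sigma> a t u \<Longrightarrow> gwa_cong R \<sigma> a s u"
| cong_Plus: "gwa_cong R \<sigma> a s s' \<Longrightarrow> gwa_cong R \<sigma> a t t' \<Longrightarrow> gwa_cong R \<sigma> a (Plus s t) (Plus s' t')"
| cong_Times: "gwa_cong R \<sigma> a s s' \<Longrightarrow> gwa_cong R \<sigma> a t t' \<Longrightarrow> gwa_cong R \<sigma> a (Times s t) (Times s' t')"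
| cong_Neg: "gwa_cong R \<sigma> a s s' \<Longrightarrow> gwa_cong R \<sigma> a (Neg s) (Neg s')"
| Plus_assoc: "\<lbrakk>gwa_wf R s; gwa_wf R t; gwa_wf R u\<rbrakk>
    \<Longrightarrow> gwa_cong R \<sigma> a (Plus (Plus s t) u) (Plus s (Plus t u))"
| Plus_comm: "\<lbrakk>gwa_wf R s; gwa_wf R t\<rbrakk> \<Longrightarrow> gwa_cong R \<sigma> a (Plus s t) (Plus t s)"
| Plus_zero: "gwa_wf R s \<Longrightarrow> gwa_cong R \<sigma> a (Plus (Coef \<zero>) s) s"
| Plus_Neg: "gwa_wf R s \<Longrightarrow> gwa_cong R \<sigma> a (Plus (Neg s) s) (Coef \<zero>)"
| Times_assoc: "\<lbrakk>gwa_wf R s; gwa_wf R t; gwa_wf R u\<rbrakk>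
    \<Longrightarrow> gwa_cong R \<sigma> a (Times (Times s t) u) (Times s (Times t u))"
| one_Times: "gwa_wf R s \<Longrightarrow> gwa_cong R \<sigma> a (Times (Coef \<one>) s) s"
| Times_one: "gwa_wf R s \<Longrightarrow> gwa_cong R \<sigma> a (Times s (Coef \<one>)) s"
| distrib_l: "\<lbrakk>gwa_wf R s; gwa_wf R t; gwa_wf R u\<rbrakk>
    \<Longrightarrow> gwa_cong R \<sigma> a (Times (Plus s t) u) (Plus (Times s u) (Times t u))"
| distrib_r: "\<lbrakk>gwa_wf R s; gwa_wf R t; gwa_wf R u\<rbrakk>
    \<Longrightarrow> gwa_cong R \<sigma> a (Times s (Plus t u)) (Plus (Times s t) (Times s u))"
| Coef_Plus: "\<lbrakk>r \<in> carrier R; q \<in> carrier R\<rbrakk>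
    \<Longrightarrow> gwa_cong R \<sigma> a (Plus (Coef r) (Coef q)) (Coef (r \<oplus> q))"
| Coef_Times: "\<lbrakk>r \<in> carrier R; q \<in> carrier R\<rbrakk>
    \<Longrightarrow> gwa_cong R \<sigma> a (Times (Coef r) (Coef q)) (Coef (r \<otimes> q))"
| rel_X: "r \<in> carrier R \<Longrightarrow> gwa_cong R \<sigma> a (Times GenX (Coef (\<sigma> r))) (Times (Coef r) GenX)"
| rel_Y: "r \<in> carrier R \<Longrightarrow> gwa_cong R \<sigma> a (Times GenY (Coef r)) (Times (Coef (\<sigma> r)) GenY)"
| rel_XY: "gwa_cong R \<sigma> a (Times GenX GenY) (Coef a)"
| rel_YX: "gwa_cong R \<sigma> a (Times GenY GenX) (Coef (\<sigma> a))"

definition gwa_class ::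
    "('r, 'x) ring_scheme \<Rightarrow> ('r \<Rightarrow> 'r) \<Rightarrow> 'r \<Rightarrow> 'r gwa_term \<Rightarrow> 'r gwa_term set"
  where "gwa_class R \<sigma> a t = {s. gwa_cong R \<sigma> a t s}"

definition GWA :: "('r, 'x) ring_scheme \<Rightarrow> ('r \<Rightarrow> 'r) \<Rightarrow> 'r \<Rightarrow> 'r gwa_term set ring"
  where "GWA R \<sigma> a =
    \<lparr>carrier = {gwa_class R \<sigma> a t | t. gwa_wf R t},
     monoid.mult = (\<lambda>C D. \<Union>s\<in>C. \<Union>t\<in>D. gwa_class R \<sigma> a (Times s t)),
     one = gwa_class R \<sigma> a (Coef \<one>\<^bsub>R\<^esub>),
     ring.zero = gwa_class R \<sigma> a (Coef \<zero>\<^bsub>R\<^esub>),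
     ring.add = (\<lambda>C D. \<Union>s\<in>C. \<Union>t\<in>D. gwa_class R \<sigma> a (Plus s t))\<rparr>"

definition gwa_of :: "('r, 'x) ring_scheme \<Rightarrow> ('r \<Rightarrow> 'r) \<Rightarrow> 'r \<Rightarrow> 'r \<Rightarrow> 'r gwa_term set"
  where "gwa_of R \<sigma> a r = gwa_class R \<sigma> a (Coef r)"

lemma gwa_class_eqI: "gwa_cong R \<sigma> a s t \<Longrightarrow> gwa_class R \<sigma> a s = gwa_class R \<sigma> a t"
  by (auto simp: gwa_class_def intro: gwa_cong.sym gwa_cong.trans)

lemma GWA_mult:
  assumes "gwa_wf R s" "gwa_wf R t"
  shows "gwa_class R \<sigma> a s \<otimes>\<^bsub>GWA R \<sigma> a\<^esub> gwa_class R \<sigma> a t = gwa_class R \<sigma> a (Times s t)"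
  using assms unfolding GWA_def gwa_class_def
  by (auto intro: gwa_cong.refl gwa_cong.sym gwa_cong.trans gwa_cong.cong_Times)

lemma GWA_add:
  assumes "gwa_wf R s" "gwa_wf R t"
  shows "gwa_class R \<sigma> a s \<oplus>\<^bsub>GWA R \<sigma> a\<^esub> gwa_class R \<sigma> a t = gwa_class R \<sigma> a (Plus s t)"
  using assms unfolding GWA_def gwa_class_def
  by (auto intro: gwa_cong.refl gwa_cong.sym gwa_cong.trans gwa_cong.cong_Plus)

lemma GWA_carrier: "carrier (GWA R \<sigma> a) = {gwa_class R \<sigma> a t | t. gwa_wf R t}"
  and GWA_one: "\<one>\<^bsub>GWA R \<sigma> a\<^esub> = gwa_class R \<sigma> a (Coef \<one>\<^bsub>R\<^esub>)"
  and GWA_zero: "\<zero>\<^bsub>GWA R \<sigma> a\<^esub> = gwa_class R \<sigma> a (Coef \<zero>\<^bsub>R\<^esub>)"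
  by (simp_all add: GWA_def)

lemma gwa_class_eq_iff:
  "gwa_wf R s \<Longrightarrow> gwa_class R \<sigma> a s = gwa_class R \<sigma> a t \<longleftrightarrow> gwa_cong R \<sigma> a s t"
  unfolding gwa_class_def by (auto intro: gwa_cong.intros(1-3))

lemma GWA_carrierI: "gwa_wf R t \<Longrightarrow> gwa_class R \<sigma> a t \<in> carrier (GWA R \<sigma> a)"
  by (auto simp: GWA_carrier)

lemma GWA_carrierE:
  assumes "C \<in> carrier (GWA R \<sigma> a)"
  obtains t where "gwa_wf R t" "C = gwa_class R \<sigma> a t"
  using assms by (auto simp: GWA_carrier)

lemma (in ring) ring_GWA:
  fixes \<sigma>
  shows "ring (GWA R \<sigma> a)"
proof (rule ringI)
  show "abelian_group (GWA R \<sigma> a)"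
  proof (rule abelian_groupI)
    fix C assume "C \<in> carrier (GWA R \<sigma> a)"
    then obtain t where t: "gwa_wf R t" "C = gwa_class R \<sigma> a t"
      by (rule GWA_carrierE)
    then have "gwa_class R \<sigma> a (Neg t) \<oplus>\<^bsub>GWA R \<sigma> a\<^esub> C = \<zero>\<^bsub>GWA R \<sigma> a\<^esub>"
      by (simp add: GWA_add GWA_zero gwa_class_eqI gwa_cong.Plus_Neg)
    moreover have "gwa_class R \<sigma> a (Neg t) \<in> carrier (GWA R \<sigma> a)"
      using t by (simp add: GWA_carrierI)
    ultimately show "\<exists>D\<in>carrier (GWA R \<sigma> a). D \<oplus>\<^bsub>GWA R \<sigma> a\<^esub> C = \<zero>\<^bsub>GWA R \<sigma> a\<^esub>"
      by blast
  qed ((elim GWA_carrierE)?; simp add: GWA_carrierI GWA_add GWA_zero gwa_class_eq_iff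
        gwa_cong.Plus_assoc gwa_cong.Plus_comm gwa_cong.Plus_zero)+
  show "monoid (GWA R \<sigma> a)"
    by (rule monoidI; (elim GWA_carrierE)?; simp add: GWA_carrierI GWA_mult GWA_one
        gwa_class_eq_iff gwa_cong.Times_assoc gwa_cong.one_Times gwa_cong.Times_one)
qed (elim GWA_carrierE; simp add: GWA_add GWA_mult gwa_class_eq_iff
      gwa_cong.distrib_l gwa_cong.distrib_r)+

lemma (in ring) gwa_of_hom:
  fixes \<sigma>
  shows "gwa_of R \<sigma> a \<in> ring_hom R (GWA R \<sigma> a)"
  by (rule ring_hom_memI)
    (simp_all add: gwa_of_def GWA_carrierI GWA_add GWA_mult GWA_one gwa_class_eq_iff
      gwa_cong.sym[OF gwa_cong.Coef_Plus] gwa_cong.sym[OF gwa_cong.Coef_Times])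

text \<open>The defining relations hold, and a ring homomorphism \<open>R \<rightarrow> B\<close> together with two elements of
  \<open>B\<close> satisfying them extends to \<open>GWA R \<sigma> a\<close>.\<close>

lemma (in ring) GWA_relations:
  fixes \<sigma>
  assumes "\<sigma> \<in> ring_auto R" "a \<in> carrier R" "r \<in> carrier R"
  defines "A \<equiv> GWA R \<sigma> a" and "x \<equiv> gwa_class R \<sigma> a GenX" and "y \<equiv> gwa_class R \<sigma> a GenY"
  shows "x \<otimes>\<^bsub>A\<^esub> gwa_of R \<sigma> a (\<sigma> r) = gwa_of R \<sigma> a r \<otimes>\<^bsub>A\<^esub> x"
    and "y \<otimes>\<^bsub>A\<^esub> gwa_of R \<sigma> a r = gwa_of R \<sigma> a (\<sigma> r) \<otimes>\<^bsub>A\<^esub> y"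
    and "x \<otimes>\<^bsub>A\<^esub> y = gwa_of R \<sigma> a a"
    and "y \<otimes>\<^bsub>A\<^esub> x = gwa_of R \<sigma> a (\<sigma> a)"
proof -
  have "\<sigma> r \<in> carrier R"
    using assms by (auto simp: ring_auto_def ring_hom_closed)
  then show "x \<otimes>\<^bsub>A\<^esub> gwa_of R \<sigma> a (\<sigma> r) = gwa_of R \<sigma> a r \<otimes>\<^bsub>A\<^esub> x"
    "y \<otimes>\<^bsub>A\<^esub> gwa_of R \<sigma> a r = gwa_of R \<sigma> a (\<sigma> r) \<otimes>\<^bsub>A\<^esub> y"
    "x \<otimes>\<^bsub>A\<^esub> y = gwa_of R \<sigma> a a" "y \<otimes>\<^bsub>A\<^esub> x = gwa_of R \<sigma> a (\<sigma> a)"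
    using assms(3) unfolding A_def x_def y_def gwa_of_def
    by (auto simp: GWA_mult intro!: gwa_class_eqI
        intro: gwa_cong.rel_X gwa_cong.rel_Y gwa_cong.rel_XY gwa_cong.rel_YX)
qed

primrec gwa_eval ::
    "('b, 'y) ring_scheme \<Rightarrow> ('r \<Rightarrow> 'b) \<Rightarrow> 'b \<Rightarrow> 'b \<Rightarrow> 'r gwa_term \<Rightarrow> 'b" where
  "gwa_eval B f u v (Coef r) = f r"
| "gwa_eval B f u v GenX = u"
| "gwa_eval B f u v GenY = v"
| "gwa_eval B f u v (Plus s t) = gwa_eval B f u v s \<oplus>\<^bsub>B\<^esub> gwa_eval B f u v t"
| "gwa_eval B f u v (Times s t) = gwa_eval B f u v s \<otimes>\<^bsub>B\<^esub> gwa_eval B f u v t"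
| "gwa_eval B f u v (Neg t) = \<ominus>\<^bsub>B\<^esub> gwa_eval B f u v t"

lemma GWA_universal:
  assumes "ring R" "ring B" and f: "f \<in> ring_hom R B"
    and uv: "u \<in> carrier B" "v \<in> carrier B"
    and rels: "\<And>r. r \<in> carrier R \<Longrightarrow> u \<otimes>\<^bsub>B\<^esub> f (\<sigma> r) = f r \<otimes>\<^bsub>B\<^esub> u"
      "\<And>r. r \<in> carrier R \<Longrightarrow> v \<otimes>\<^bsub>B\<^esub> f r = f (\<sigma> r) \<otimes>\<^bsub>B\<^esub> v"
      "u \<otimes>\<^bsub>B\<^esub> v = f a" "v \<otimes>\<^bsub>B\<^esub> u = f (\<sigma> a)"
  obtains h where "h \<in> ring_hom (GWA R \<sigma> a) B"
    "\<And>r. r \<in> carrier R \<Longrightarrow> h (gwa_of R \<sigma> a r) = f r"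
    "h (gwa_class R \<sigma> a GenX) = u" "h (gwa_class R \<sigma> a GenY) = v"
proof -
  interpret R: ring R by fact
  interpret B: ring B by fact
  let ?e = "gwa_eval B f u v"
  have cl: "?e t \<in> carrier B" if "gwa_wf R t" for t
    using that uv ring_hom_closed[OF f] by (induction t) auto
  have f0: "f \<zero>\<^bsub>R\<^esub> = \<zero>\<^bsub>B\<^esub>"
    using ring_hom_zero[OF f \<open>ring R\<close> \<open>ring B\<close>] .
  have neg: "(\<ominus>\<^bsub>B\<^esub> b) \<oplus>\<^bsub>B\<^esub> b = \<zero>\<^bsub>B\<^esub>" "b \<oplus>\<^bsub>B\<^esub> (\<ominus>\<^bsub>B\<^esub> b) = \<zero>\<^bsub>B\<^esub>" if "b \<in> carrier B" for b
    using that by (simp_all add: B.l_neg B.r_neg)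
  have eq: "?e s = ?e t" if "gwa_cong R \<sigma> a s t" for s t
    using that
  proof induction
    case (Plus_comm s t)
    then show ?case by (simp add: cl B.a_comm)
  qed (simp_all add: cl f0 neg ring_hom_one[OF f] ring_hom_add[OF f] ring_hom_mult[OF f] rels
        B.a_assoc B.m_assoc B.l_distr B.r_distr)
  define h where "h C = ?e (SOME t. t \<in> C)" for C
  have h: "h (gwa_class R \<sigma> a t) = ?e t" if "gwa_wf R t" for t
  proof -
    have "(SOME s. s \<in> gwa_class R \<sigma> a t) \<in> gwa_class R \<sigma> a t"
      by (rule someI[of _ t]) (simp add: gwa_class_def gwa_cong.refl that)
    then have "gwa_cong R \<sigma> a t (SOME s. s \<in> gwa_class R \<sigma> a t)"
      by (simp add: gwa_class_def)
    then show ?thesis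
      unfolding h_def using eq by metis
  qed
  have "h \<in> ring_hom (GWA R \<sigma> a) B"
    by (rule ring_hom_memI)
      (auto simp: GWA_carrier GWA_mult GWA_add GWA_one h cl ring_hom_one[OF f])
  then show thesis
    by (rule that) (simp_all add: gwa_of_def h)
qed

end

(*
A basis m of M over R is described by p, q in R with x m = p m, y m = q m, and then
sigma(p) q = sigma(a). Submodules of M are ideals f R with f | sigma(f) q and
sigma(f) | f sigma(p). If f is nonzero, then f m is again the basis of a module of the same kind:
with P, Q, F the multisets of irreducible factors of sigma(p), q, f, and s the action of sigma on
irreducible classes, passing from m to f m replaces (Q, P) by (Q + sF - F, P + F - sF).
Let J(Q, P) be the number of pairs in Q x P whose second component is a strictly positive s-iterate
of the first. Since s has no periodic points, J drops by at least the number of equal pairs in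
Q x F, and this number is positive if F is nonempty: otherwise F is contained in sF, so the finite
multiset F would be s-invariant. Hence a chain of nonzero submodules has at most
J(Q, P) <= |Q| |P| <= (deg(a)/2)^2 strict inclusions.
*)

theory Submission
  imports Defs
begin


section \<open>Counting related pairs in two multisets\<close>

text \<open>Pairs are counted with multiplicity, so the count is additive in each multiset. With
  \<open>precedes s\<close> for \<open>E\<close> it is the quantity J of the overview; with equality
  it measures by how much J drops.\<close>

definition related_pairs :: "('b \<Rightarrow> 'b \<Rightarrow> bool) \<Rightarrow> 'b multiset \<Rightarrow> 'b multiset \<Rightarrow> nat"
  where "related_pairs E A B = (\<Sum>x\<in>#A. size (filter_mset (E x) B))"

lemma related_pairs_add_left:
  "related_pairs E (A + A') B = related_pairs E A B + related_pairs E A' B"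
  by (simp add: related_pairs_def)

lemma related_pairs_add_right:
  "related_pairs E A (B + B') = related_pairs E A B + related_pairs E A B'"
  by (simp add: related_pairs_def sum_mset.distrib)

lemma related_pairs_image_left:
  "related_pairs E (image_mset f A) B = related_pairs (\<lambda>x. E (f x)) A B"
  by (simp add: related_pairs_def image_mset.compositionality comp_def)

lemma related_pairs_image_right:
  "related_pairs E A (image_mset f B) = related_pairs (\<lambda>x y. E x (f y)) A B"
  by (simp add: related_pairs_def filter_mset_image_mset comp_def)

lemma related_pairs_le: "related_pairs E A B \<le> size A * size B"
proof (induction A)
  case (add x A)
  have "size (filter_mset (E x) B) \<le> size B"
    by (simp add: size_filter_mset_lesseq)
  with add show ?case unfolding related_pairs_def by (simp add: add_mono)
qed (simp add: related_pairs_def)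

lemma related_pairs_pos:
  assumes "x \<in># A" "y \<in># B" "E x y"
  shows "related_pairs E A B > 0"
proof -
  obtain A' where A': "A = add_mset x A'" using assms(1) by (meson mset_add)
  have "y \<in># filter_mset (E x) B" using assms(2,3) by simp
  then have "0 < size (filter_mset (E x) B)" by (metis nonempty_has_size empty_iff set_mset_empty)
  then show ?thesis by (simp add: related_pairs_def A')
qed

text \<open>The hypotheses range only over members of \<open>A\<close> and \<open>B\<close>, because
  the case splits used below rely on membership in the set on which the map iterates freely.\<close>

lemma related_pairs_disj:
  assumes "\<And>x y. x \<in># A \<Longrightarrow> y \<in># B \<Longrightarrow> E x y \<longleftrightarrow> E1 x y \<or> E2 x y"
    and "\<And>x y. x \<in># A \<Longrightarrow> y \<in># B \<Longrightarrow> \<not> (E1 x y \<and> E2 x y)"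
  shows "related_pairs E A B = related_pairs E1 A B + related_pairs E2 A B"
proof -
  have "size (filter_mset (E x) B) = size (filter_mset (E1 x) B) + size (filter_mset (E2 x) B)"
    if "x \<in># A" for x
  proof -
    have "filter_mset (E x) B = filter_mset (E1 x) B + filter_mset (E2 x) B"
    proof (rule multiset_eqI)
      fix y
      show "count (filter_mset (E x) B) y = count (filter_mset (E1 x) B + filter_mset (E2 x) B) y"
        using assms[OF that, of y] by (cases "y \<in># B") (auto simp: not_in_iff)
    qed
    then show ?thesis by simp
  qed
  then show ?thesis
    unfolding related_pairs_def sum_mset.distrib[symmetric]
    by (intro arg_cong[where f = sum_mset] image_mset_cong) auto
qed

section \<open>Iterates of an injective map without periodic points\<close>

text \<open>Abstracts the action of the automorphism on \<open>Irr R\<close>. Writing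
  \<open>Suc t\<close> keeps the identity iterate out of the condition on periods.\<close>

definition iterates_freely :: "('b \<Rightarrow> 'b) \<Rightarrow> 'b set \<Rightarrow> bool"
  where "iterates_freely s U \<longleftrightarrow>
    s ` U \<subseteq> U \<and> inj_on s U \<and> (\<forall>x\<in>U. \<forall>t. (s ^^ Suc t) x \<noteq> x)"

text \<open>On \<open>U\<close> this is a strict order along the orbits: the absence of periodic
  points makes it irreflexive.\<close>

definition precedes :: "('b \<Rightarrow> 'b) \<Rightarrow> 'b \<Rightarrow> 'b \<Rightarrow> bool"
  where "precedes s x y \<longleftrightarrow> (\<exists>t. (s ^^ Suc t) x = y)"

lemma iterates_freelyD:
  assumes "iterates_freely s U"
  shows "x \<in> U \<Longrightarrow> s x \<in> U" and "inj_on s U" and "x \<in> U \<Longrightarrow> (s ^^ Suc t) x \<noteq> x"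
  using assms by (auto simp: iterates_freely_def simp del: funpow.simps)

lemma iterates_freely_funpow: "iterates_freely s U \<Longrightarrow> x \<in> U \<Longrightarrow> (s ^^ t) x \<in> U"
  by (induction t) (auto intro: iterates_freelyD(1))

text \<open>Injectivity cancels one application of \<open>s\<close>, so a positive iterate of
  \<open>x\<close> reaching \<open>s y\<close> is an arbitrary iterate reaching \<open>y\<close>;
  the zeroth iterate is the equality case.\<close>

lemma precedes_right:
  assumes s: "iterates_freely s U" and "x \<in> U" "y \<in> U"
  shows "precedes s x (s y) \<longleftrightarrow> precedes s x y \<or> x = y"
proof -
  have "precedes s x (s y) \<longleftrightarrow> (\<exists>t. (s ^^ t) x = y)"
    using assms(2,3) iterates_freelyD(2)[OF s] iterates_freely_funpow[OF s] unfolding precedes_def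
    by (auto simp: inj_on_eq_iff)
  also have "\<dots> \<longleftrightarrow> precedes s x y \<or> x = y"
    unfolding precedes_def by (metis funpow_0 old.nat.exhaust)
  finally show ?thesis .
qed

text \<open>A positive iterate of \<open>x\<close> is an arbitrary iterate of \<open>s x\<close>,
  and the zeroth one is the equality case.\<close>

lemma precedes_left: "precedes s x y \<longleftrightarrow> precedes s (s x) y \<or> s x = y"
proof -
  have "precedes s x y \<longleftrightarrow> (\<exists>t. (s ^^ t) (s x) = y)"
    by (simp add: precedes_def funpow_Suc_right del: funpow.simps)
  also have "\<dots> \<longleftrightarrow> precedes s (s x) y \<or> s x = y"
    unfolding precedes_def by (metis funpow_0 old.nat.exhaust)
  finally show ?thesis .
qed

lemma not_precedes_self: "iterates_freely s U \<Longrightarrow> x \<in> U \<Longrightarrow> \<not> precedes s x x"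
  using iterates_freelyD(3) by (metis precedes_def)

text \<open>The additive equations say that \<open>P'\<close> is P + F - sF and \<open>Q'\<close> is
  Q + sF - F without truncated subtraction. By additivity, J(Q, P) - J(Q', P') is exactly the number
  of equal pairs in Q x F plus that in sF x P'; only the first summand is kept.\<close>

lemma related_pairs_drop:
  assumes s: "iterates_freely s U"
    and U: "set_mset P \<subseteq> U" "set_mset Q \<subseteq> U" "set_mset F \<subseteq> U"
    and P: "P + F = image_mset s F + P'" and Q: "Q + image_mset s F = F + Q'"
  shows "related_pairs (precedes s) Q P \<ge> related_pairs (=) Q F + related_pairs (precedes s) Q' P'"
proof -
  let ?J = "related_pairs (precedes s)" and ?D = "related_pairs (=)"
  \<comment> \<open>First move, with \<open>Q\<close> fixed: together with the next equation this
    gives J(Q, P) = J(Q, P') + D(Q, F).\<close>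
  have "?J Q P + ?J Q F = ?J Q (image_mset s F) + ?J Q P'"
    by (metis P related_pairs_add_right)
  moreover have "?J Q (image_mset s F) = ?J Q F + ?D Q F"
    unfolding related_pairs_image_right
  proof (rule related_pairs_disj)
    fix x y assume "x \<in># Q" "y \<in># F"
    then have xy: "x \<in> U" "y \<in> U" using U(2,3) by auto
    show "precedes s x (s y) \<longleftrightarrow> precedes s x y \<or> x = y"
      by (rule precedes_right[OF s xy])
    show "\<not> (precedes s x y \<and> x = y)"
      using not_precedes_self[OF s xy(1)] by auto
  qed
  \<comment> \<open>Second move, with \<open>P'\<close> fixed: J(Q, P') = J(Q', P') + D(sF,
    P').\<close>
  moreover have "?J Q P' + ?J (image_mset s F) P' = ?J F P' + ?J Q' P'"
    by (metis Q related_pairs_add_left)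
  moreover have "?J F P' = ?J (image_mset s F) P' + related_pairs (=) (image_mset s F) P'"
    unfolding related_pairs_image_left
  proof (rule related_pairs_disj)
    fix x y assume "x \<in># F"
    then have x: "s x \<in> U" using U(3) iterates_freelyD(1)[OF s] by auto
    show "precedes s x y \<longleftrightarrow> precedes s (s x) y \<or> s x = y"
      by (rule precedes_left)
    show "\<not> (precedes s (s x) y \<and> s x = y)"
      using not_precedes_self[OF s x] by auto
  qed
  ultimately show ?thesis by linarith
qed

text \<open>\<open>F\<close> and its image have the same size, so inclusion forces equality. The
  finite support is then stable under \<open>s\<close>, the iterates of a member must repeat, and a
  repetition is a periodic point.\<close>

lemma no_invariant_mset:
  assumes s: "iterates_freely s U"
    and U: "set_mset F \<subseteq> U" and F: "F \<subseteq># image_mset s F"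
  shows "F = {#}"
proof (rule ccontr)
  assume "F \<noteq> {#}"
  then obtain x where x: "x \<in># F" by auto
  have eq: "image_mset s F = F"
    using mset_subset_size[of F "image_mset s F"] F by (auto simp: subset_mset.le_less)
  have iter: "(s ^^ t) x \<in># F" for t
  proof (induction t)
    case (Suc t)
    then have "s ((s ^^ t) x) \<in># image_mset s F" by simp
    then show ?case using eq by simp
  qed (simp add: x)
  have "\<not> inj (\<lambda>t. (s ^^ t) x)"
  proof
    assume "inj (\<lambda>t. (s ^^ t) x)"
    then have "infinite (range (\<lambda>t. (s ^^ t) x))" by (rule range_inj_infinite)
    moreover have "range (\<lambda>t. (s ^^ t) x) \<subseteq> set_mset F" using iter by auto
    ultimately show False using finite_subset by blast
  qed
  then obtain i j where ij: "(s ^^ i) x = (s ^^ j) x" "i < j"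
    unfolding inj_def by (metis linorder_neqE_nat)
  \<comment> \<open>The periodic point is the i-th iterate, with period j - i written as a successor
    to match \<open>iterates_freely\<close>.\<close>
  have "(s ^^ Suc (j - Suc i)) ((s ^^ i) x) = (s ^^ i) x"
  proof -
    have "(s ^^ Suc (j - Suc i)) ((s ^^ i) x) = (s ^^ (Suc (j - Suc i) + i)) x"
      by (simp only: funpow_add comp_apply)
    also have "Suc (j - Suc i) + i = j" using ij(2) by simp
    finally show ?thesis using ij(1) by simp
  qed
  moreover have "(s ^^ i) x \<in> U" using iter U by blast
  ultimately show False using iterates_freelyD(3)[OF s] by metis
qed

lemma related_pairs_strict_drop:
  assumes s: "iterates_freely s U"
    and U: "set_mset P \<subseteq> U" "set_mset Q \<subseteq> U" "set_mset F \<subseteq> U"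
    and P: "P + F = image_mset s F + P'" and Q: "Q + image_mset s F = F + Q'"
    and "F \<noteq> {#}"
  shows "related_pairs (precedes s) Q' P' < related_pairs (precedes s) Q P"
proof -
  have "\<not> (\<forall>x\<in>#F. x \<notin># Q)"
  proof
    assume neg: "\<forall>x\<in>#F. x \<notin># Q"
    have "F \<subseteq># image_mset s F"
    proof (rule mset_subset_eqI)
      fix x
      show "count F x \<le> count (image_mset s F) x"
      proof (cases "x \<in># F")
        case True
        \<comment> \<open>With no \<open>x\<close> in \<open>Q\<close>, the equation for
          \<open>Q'\<close> says that the image of \<open>F\<close> contains \<open>x\<close> as
          often as \<open>F\<close> and \<open>Q'\<close> together.\<close>
        then have "count Q x = 0" using neg by (auto simp: not_in_iff)
        then show ?thesis using arg_cong[OF Q, of "\<lambda>M. count M x"] by simp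
      qed (simp add: not_in_iff)
    qed
    then show False using no_invariant_mset[OF s] U \<open>F \<noteq> {#}\<close> by blast
  qed
  then obtain x where "x \<in># Q" "x \<in># F" by auto
  then have "related_pairs (=) Q F > 0" by (rule related_pairs_pos) simp
  then show ?thesis using related_pairs_drop[OF s U P Q] by linarith
qed

text \<open>In the application \<open>F i\<close> belongs to the generator of the i-th nonzero
  submodule: \<open>F\<close> shrinks as the submodules grow, so J increases along the index. The
  two inclusion hypotheses are the divisibilities forced by the actions of x and y.\<close>

lemma chain_length_le:
  assumes s: "iterates_freely s U"
    and "set_mset P \<subseteq> U" "set_mset Q \<subseteq> U"
    and "\<And>i. i \<le> n \<Longrightarrow> set_mset (F i) \<subseteq> U"
    and "\<And>i. i \<le> n \<Longrightarrow> image_mset s (F i) \<subseteq># P + F i"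
    and "\<And>i. i \<le> n \<Longrightarrow> F i \<subseteq># Q + image_mset s (F i)"
    and "\<And>i. i < n \<Longrightarrow> F (Suc i) \<subset># F i"
  shows "n \<le> size P * size Q"
proof -
  define P' where "P' i = P + F i - image_mset s (F i)" for i
  define Q' where "Q' i = Q + image_mset s (F i) - F i" for i
  define J where "J i = related_pairs (precedes s) (Q' i) (P' i)" for i
  \<comment> \<open>The inclusion hypotheses make the truncated subtractions in \<open>P'\<close>
    and \<open>Q'\<close> exact.\<close>
  have P': "image_mset s (F i) + P' i = P + F i" if "i \<le> n" for i
    using assms(5)[OF that] by (simp add: P'_def)
  have Q': "F i + Q' i = Q + image_mset s (F i)" if "i \<le> n" for i
    using assms(6)[OF that] by (simp add: Q'_def)
  have sub: "set_mset (P' i) \<subseteq> U" "set_mset (Q' i) \<subseteq> U" if "i \<le> n" for i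
  proof -
    have "set_mset (P' i) \<subseteq> set_mset (P + F i)"
      by (auto simp: P'_def dest: in_diffD)
    then show "set_mset (P' i) \<subseteq> U" using assms(2) assms(4)[OF that] by auto
    have "set_mset (Q' i) \<subseteq> set_mset (Q + image_mset s (F i))"
      by (auto simp: Q'_def dest: in_diffD)
    moreover have "s ` set_mset (F i) \<subseteq> U"
      using assms(4)[OF that] iterates_freelyD(1)[OF s] by auto
    ultimately show "set_mset (Q' i) \<subseteq> U" using assms(3) by auto
  qed
  \<comment> \<open>Going from index \<open>Suc i\<close> back to \<open>i\<close> enlarges the
    factor multiset by \<open>G\<close>, so the strict drop is applied with
    \<open>P' (Suc i)\<close> and \<open>Q' (Suc i)\<close> as the starting pair.\<close>
  have "J i < J (Suc i)" if "i < n" for i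
  proof -
    have "F (Suc i) \<subset># F i" by (rule assms(7)[OF that])
    then obtain G where G: "F i = F (Suc i) + G" "G \<noteq> {#}"
      by (metis add.right_neutral mset_subset_eq_exists_conv subset_mset.less_le)
    have "set_mset G \<subseteq> U" using assms(4)[of i] G that by auto
    moreover have "P' (Suc i) + G = image_mset s G + P' i"
    proof (rule multiset_eqI)
      fix x
      have "count (image_mset s (F i) + P' i) x = count (P + F i) x"
        "count (image_mset s (F (Suc i)) + P' (Suc i)) x = count (P + F (Suc i)) x"
        using P'[of i] P'[of "Suc i"] that by simp_all
      then show "count (P' (Suc i) + G) x = count (image_mset s G + P' i) x"
        by (simp add: G(1))
    qed
    moreover have "Q' (Suc i) + image_mset s G = G + Q' i"
    proof (rule multiset_eqI)
      fix x
      have "count (F i + Q' i) x = count (Q + image_mset s (F i)) x"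
        "count (F (Suc i) + Q' (Suc i)) x = count (Q + image_mset s (F (Suc i))) x"
        using Q'[of i] Q'[of "Suc i"] that by simp_all
      then show "count (Q' (Suc i) + image_mset s G) x = count (G + Q' i) x"
        by (simp add: G(1))
    qed
    ultimately show ?thesis
      unfolding J_def using sub that G(2) by (intro related_pairs_strict_drop[OF s, of _ _ G]) auto
  qed
  then have "i \<le> n \<Longrightarrow> i \<le> J i" for i
    by (induction i) (auto simp: Suc_le_eq intro: le_less_trans)
  then have "n \<le> J n" by simp
  also have "\<dots> \<le> size (Q' n) * size (P' n)" by (simp add: J_def related_pairs_le)
  \<comment> \<open>\<open>F n\<close> and its image have equal size, so trading one for the other
    leaves the size of \<open>Q\<close>, and likewise of \<open>P\<close>, unchanged.\<close>
  also have "size (Q' n) = size Q"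
    using arg_cong[OF Q'[of n], of size] by simp
  also have "size (P' n) = size P"
    using arg_cong[OF P'[of n], of size] by simp
  finally show ?thesis by (simp add: mult.commute)
qed

section \<open>Multisets of irreducible factors in a principal ideal domain\<close>

context principal_domain
begin

text \<open>\<open>mult_of R\<close> is the monoid of nonzero elements, where factorization theory
  applies. The choice of \<open>fs\<close> is harmless for nonzero \<open>f\<close>, since
  factorizations are essentially unique.\<close>

definition factor_mset :: "'a \<Rightarrow> 'a set multiset"
  where "factor_mset f = fmset (mult_of R)
    (SOME fs. set fs \<subseteq> carrier (mult_of R) \<and> wfactors (mult_of R) fs f)"

lemma factor_mset_eq:
  assumes f: "f \<in> carrier (mult_of R)"
    and fs: "set fs \<subseteq> carrier (mult_of R)" "wfactors (mult_of R) fs f"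
  shows "factor_mset f = fmset (mult_of R) fs"
proof -
  define gs where "gs = (SOME fs. set fs \<subseteq> carrier (mult_of R) \<and> wfactors (mult_of R) fs f)"
  have gs: "set gs \<subseteq> carrier (mult_of R) \<and> wfactors (mult_of R) gs f"
    unfolding gs_def by (rule someI) (use fs in blast)
  have "essentially_equal (mult_of R) gs fs"
    using gs fs f mult_of.wfactors_unique by blast
  then show ?thesis
    unfolding factor_mset_def gs_def[symmetric] using gs fs by (intro mult_of.ee_fmset) auto
qed

lemma factor_mset_obtain:
  assumes f: "f \<in> carrier (mult_of R)"
  obtains fs where "set fs \<subseteq> carrier (mult_of R)" "wfactors (mult_of R) fs f"
    "factor_mset f = fmset (mult_of R) fs"
proof -
  obtain fs where fs: "set fs \<subseteq> carrier (mult_of R)" "wfactors (mult_of R) fs f"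
    using mult_of.wfactors_exist[OF f] by (elim exE conjE)
  show thesis by (rule that[OF fs factor_mset_eq[OF f fs]])
qed

lemma factor_mset_mult:
  assumes "f \<in> carrier (mult_of R)" "g \<in> carrier (mult_of R)"
  shows "factor_mset (f \<otimes> g) = factor_mset f + factor_mset g"
proof -
  obtain fs gs where fs: "set fs \<subseteq> carrier (mult_of R)" "wfactors (mult_of R) fs f"
      "factor_mset f = fmset (mult_of R) fs"
    and gs: "set gs \<subseteq> carrier (mult_of R)" "wfactors (mult_of R) gs g"
      "factor_mset g = fmset (mult_of R) gs"
    using assms factor_mset_obtain by metis
  have "wfactors (mult_of R) (fs @ gs) (f \<otimes> g)"
    using mult_of.wfactors_mult[OF fs(2) gs(2) assms fs(1) gs(1)] .
  then have "factor_mset (f \<otimes> g) = fmset (mult_of R) (fs @ gs)"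
    using mult_of.m_closed[OF assms] fs(1) gs(1) by (intro factor_mset_eq) auto
  then show ?thesis
    by (simp add: fs(3) gs(3) fmset_def)
qed

lemma divides_iff_factor_mset:
  assumes "f \<in> carrier (mult_of R)" "g \<in> carrier (mult_of R)"
  shows "f divides g \<longleftrightarrow> factor_mset f \<subseteq># factor_mset g"
proof -
  obtain fs gs where fs: "set fs \<subseteq> carrier (mult_of R)" "wfactors (mult_of R) fs f"
      "factor_mset f = fmset (mult_of R) fs"
    and gs: "set gs \<subseteq> carrier (mult_of R)" "wfactors (mult_of R) gs g"
      "factor_mset g = fmset (mult_of R) gs"
    using assms factor_mset_obtain by metis
  have "f divides g \<longleftrightarrow> f divides\<^bsub>mult_of R\<^esub> g"
    using assms by auto
  also have "\<dots> \<longleftrightarrow> factor_mset f \<subseteq># factor_mset g"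
    unfolding fs(3) gs(3)
    using mult_of.divides_as_fmsubset[OF fs(2) gs(2) assms fs(1) gs(1)] .
  finally show ?thesis .
qed

lemma size_factor_mset:
  assumes "f \<in> carrier (mult_of R)"
  shows "size (factor_mset f) = factorcount (mult_of R) f"
proof -
  obtain fs where fs: "set fs \<subseteq> carrier (mult_of R)" "wfactors (mult_of R) fs f"
      "factor_mset f = fmset (mult_of R) fs"
    using assms factor_mset_obtain by metis
  show ?thesis
    unfolding fs(3) mult_of.factorcount_unique[OF fs(2) assms fs(1)] by (simp add: fmset_def)
qed

text \<open>Links the classes used by \<open>fmset\<close> with those used by \<open>Irr\<close>:
  zero is not associated to a nonzero element, so removing it from the ring does not alter the
  class.\<close>

lemma assocs_mult_of:
  assumes "x \<in> carrier (mult_of R)"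
  shows "assocs (mult_of R) x = assoc_class R x"
proof -
  have "y \<in> carrier R \<and> y \<noteq> \<zero> \<and> y \<sim>\<^bsub>mult_of R\<^esub> x \<longleftrightarrow> y \<in> carrier R \<and> y \<sim> x" for y
  proof -
    have "\<not> \<zero> \<sim> x"
      using assms by (auto simp: associated_def zero_divides)
    then show ?thesis
      using assms assoc_iff_assoc_mult[of y x] by auto
  qed
  then show ?thesis
    by (auto simp: eq_closure_of_def elem_def assoc_class_def)
qed

lemma fmset_eq_assoc_classes:
  assumes "set fs \<subseteq> carrier (mult_of R)"
  shows "fmset (mult_of R) fs = mset (map (assoc_class R) fs)"
proof -
  have "map (assocs (mult_of R)) fs = map (assoc_class R) fs"
  proof (rule map_cong[OF HOL.refl])
    fix p assume "p \<in> set fs"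
    then have "p \<in> carrier (mult_of R)" using assms by (rule subsetD[rotated])
    then show "assocs (mult_of R) p = assoc_class R p" by (rule assocs_mult_of)
  qed
  then show ?thesis by (simp only: fmset_def)
qed

lemma set_factor_mset:
  assumes "f \<in> carrier (mult_of R)"
  shows "set_mset (factor_mset f) \<subseteq> Defs.Irr R"
proof -
  obtain fs where fs: "set fs \<subseteq> carrier (mult_of R)" "wfactors (mult_of R) fs f"
      "factor_mset f = fmset (mult_of R) fs"
    using assms factor_mset_obtain by metis
  have "assoc_class R p \<in> Defs.Irr R" if "p \<in> set fs" for p
  proof -
    have "p \<in> carrier R - {\<zero>}" "irreducible (mult_of R) p"
      using fs(1,2) that by (auto simp: wfactors_def)
    then have "ring_irreducible p"
      using irreducible_mult_imp_irreducible by (auto simp: ring_irreducible_def)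
    then show ?thesis
      using \<open>p \<in> carrier R - {\<zero>}\<close> by (auto simp: Defs.Irr_def)
  qed
  then show ?thesis
    unfolding fs(3) fmset_eq_assoc_classes[OF fs(1)] by auto
qed

section \<open>Automorphisms and irreducible factors\<close>

lemma ring_auto_bij: "\<tau> \<in> ring_auto R \<Longrightarrow> bij_betw \<tau> (carrier R) (carrier R)"
  by (simp add: ring_auto_def Bij_def)

lemma ring_auto_hom: "\<tau> \<in> ring_auto R \<Longrightarrow> \<tau> \<in> ring_hom R R"
  by (simp add: ring_auto_def)

lemma ring_auto_closed: "\<tau> \<in> ring_auto R \<Longrightarrow> r \<in> carrier R \<Longrightarrow> \<tau> r \<in> carrier R"
  by (rule ring_hom_closed[OF ring_auto_hom])

lemma ring_auto_zero: "\<tau> \<in> ring_auto R \<Longrightarrow> \<tau> \<zero> = \<zero>"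
  using ring_hom_zero[OF ring_auto_hom ring_axioms ring_axioms] .

lemma ring_auto_nonzero:
  assumes "\<tau> \<in> ring_auto R" "r \<in> carrier (mult_of R)"
  shows "\<tau> r \<in> carrier (mult_of R)"
proof -
  have "\<tau> r \<noteq> \<tau> \<zero>"
    using assms ring_auto_bij[OF assms(1)] by (auto simp: bij_betw_def inj_on_def)
  then show ?thesis
    using assms ring_auto_zero[OF assms(1)] ring_auto_closed[OF assms(1)] by auto
qed

lemma ring_auto_Units:
  assumes "\<tau> \<in> ring_auto R" "r \<in> carrier R"
  shows "\<tau> r \<in> Units R \<longleftrightarrow> r \<in> Units R"
proof -
  have "\<tau> r \<in> Units R \<longleftrightarrow> \<tau> r divides \<tau> \<one>"
    using divides_one[OF ring_auto_closed[OF assms]] ring_hom_one[OF ring_auto_hom[OF assms(1)]] by simp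
  also have "\<dots> \<longleftrightarrow> r \<in> Units R"
    unfolding ring_auto_divides[OF assms one_closed] by (rule divides_one[OF assms(2)])
  finally show ?thesis .
qed

lemma ring_auto_irreducible:
  assumes "\<tau> \<in> ring_auto R" "p \<in> carrier R" "irreducible R p"
  shows "irreducible R (\<tau> p)"
proof (rule irreducibleI)
  show "\<tau> p \<notin> Units R"
    using assms ring_auto_Units by (auto simp: irreducible_def)
  fix b assume b: "b \<in> carrier R" "properfactor R b (\<tau> p)"
  then obtain c where c: "c \<in> carrier R" "b = \<tau> c"
    using ring_auto_bij[OF assms(1)] by (metis bij_betw_def imageE)
  then have "properfactor R c p"
    using b assms(1,2) ring_auto_divides by (simp add: properfactor_def)
  then show "b \<in> Units R"
    using assms c ring_auto_Units by (auto simp: irreducible_def)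
qed

text \<open>The automorphism commutes with the product of the list and preserves associates and
  irreducibility. These facts hold in \<open>R\<close> and are carried over to
  \<open>mult_of R\<close>.\<close>

lemma ring_auto_wfactors:
  assumes \<tau>: "\<tau> \<in> ring_auto R" and f: "f \<in> carrier (mult_of R)"
    and fs: "set fs \<subseteq> carrier (mult_of R)" "wfactors (mult_of R) fs f"
  shows "wfactors (mult_of R) (map \<tau> fs) (\<tau> f)"
proof -
  have h: "\<tau> \<in> ring_hom R R" using ring_auto_hom[OF \<tau>] .
  have cl: "foldr (\<otimes>) gs \<one> \<in> carrier R" if "set gs \<subseteq> carrier (mult_of R)" for gs
    using that by (induction gs) auto
  have "foldr (\<otimes>) (map \<tau> gs) \<one> = \<tau> (foldr (\<otimes>) gs \<one>)" if "set gs \<subseteq> carrier (mult_of R)" for gs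
    using that by (induction gs) (auto simp: ring_hom_one[OF h] ring_hom_mult[OF h] cl)
  moreover have "foldr (\<otimes>) fs \<one> \<sim> f"
    using fs cl[OF fs(1)] f assoc_iff_assoc_mult by (auto simp: wfactors_def)
  then have "\<tau> (foldr (\<otimes>) fs \<one>) \<sim> \<tau> f"
    using \<tau> f cl[OF fs(1)] ring_auto_divides by (auto simp: associated_def)
  ultimately have "foldr (\<otimes>) (map \<tau> fs) \<one> \<sim>\<^bsub>mult_of R\<^esub> \<tau> f"
    using fs(1) f \<tau> cl[OF fs(1)] ring_auto_closed assoc_iff_assoc_mult by auto
  moreover have "irreducible (mult_of R) (\<tau> p)" if "p \<in> set fs" for p
  proof -
    have "p \<in> carrier R - {\<zero>}" "irreducible (mult_of R) p"
      using fs that by (auto simp: wfactors_def)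
    then have "irreducible R (\<tau> p)"
      using irreducible_mult_imp_irreducible ring_auto_irreducible \<tau> by auto
    then show ?thesis
      using irreducible_imp_irreducible_mult ring_auto_closed[OF \<tau>] \<open>p \<in> carrier R - {\<zero>}\<close> by auto
  qed
  ultimately show ?thesis
    by (auto simp: wfactors_def)
qed

text \<open>Turns divisibilities that involve \<open>\<tau> f\<close> into inclusions between
  multisets and their images under the action, the form required by the counting argument.\<close>

lemma factor_mset_ring_auto:
  assumes \<tau>: "\<tau> \<in> ring_auto R" and f: "f \<in> carrier (mult_of R)"
  shows "factor_mset (\<tau> f) = image_mset (Irr_action \<tau>) (factor_mset f)"
proof -
  obtain fs where fs: "set fs \<subseteq> carrier (mult_of R)" "wfactors (mult_of R) fs f"
      "factor_mset f = fmset (mult_of R) fs"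
    using f factor_mset_obtain by metis
  have set: "set (map \<tau> fs) \<subseteq> carrier (mult_of R)"
    using fs(1) ring_auto_nonzero[OF \<tau>] by auto
  have "factor_mset (\<tau> f) = fmset (mult_of R) (map \<tau> fs)"
    by (rule factor_mset_eq[OF ring_auto_nonzero[OF \<tau> f] set ring_auto_wfactors[OF \<tau> f fs(1,2)]])
  also have "\<dots> = mset (map (\<lambda>p. assoc_class R (\<tau> p)) fs)"
    unfolding fmset_eq_assoc_classes[OF set] by (simp add: comp_def)
  also have "map (\<lambda>p. assoc_class R (\<tau> p)) fs = map (\<lambda>p. Irr_action \<tau> (assoc_class R p)) fs"
    using fs(1) image_assoc_class[OF \<tau>] by (intro map_cong) auto
  also have "mset \<dots> = image_mset (Irr_action \<tau>) (factor_mset f)"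
    unfolding fs(3) fmset_eq_assoc_classes[OF fs(1)]
    by (simp add: image_mset.compositionality comp_def)
  finally show ?thesis .
qed

text \<open>A periodic class would have a finite forward orbit \<open>S\<close>. Periodicity also
  provides predecessors in \<open>S\<close>, so \<open>S\<close> is stable under the inverse and
  hence under the whole cyclic group, and the group orbit would be finite.\<close>

lemma iterates_freely_Irr_action:
  assumes \<tau>: "\<tau> \<in> ring_auto R" and inf: "\<forall>orb\<in>Irr_orbits R \<tau>. infinite orb"
  shows "iterates_freely (Irr_action \<tau>) (Defs.Irr R)"
  unfolding iterates_freely_def
proof (intro conjI ballI allI notI)
  let ?s = "Irr_action \<tau>"
  have sub: "C \<subseteq> carrier R" if "C \<in> Defs.Irr R" for C
    using that by (auto simp: Defs.Irr_def assoc_class_def)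
  show maps: "?s ` Defs.Irr R \<subseteq> Defs.Irr R"
  proof
    fix D assume "D \<in> ?s ` Defs.Irr R"
    then obtain p where p: "p \<in> carrier R" "ring_irreducible p" "D = ?s (assoc_class R p)"
      by (auto simp: Defs.Irr_def)
    then have "D = assoc_class R (\<tau> p)"
      using image_assoc_class \<tau> by simp
    moreover have "ring_irreducible (\<tau> p)"
      using p ring_auto_irreducible[OF \<tau>] ring_auto_nonzero[OF \<tau>, of p]
      by (auto simp: ring_irreducible_def)
    ultimately show "D \<in> Defs.Irr R"
      using ring_auto_closed[OF \<tau> p(1)] by (auto simp: Defs.Irr_def)
  qed
  have inj: "inj_on \<tau> (carrier R)"
    using ring_auto_bij[OF \<tau>] by (simp add: bij_betw_def)
  show "inj_on ?s (Defs.Irr R)"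
    unfolding Irr_action_def using sub inj by (intro inj_onI) (metis inj_on_image_eq_iff)
  fix C t assume C: "C \<in> Defs.Irr R" and period: "(?s ^^ Suc t) C = C"
  define S where "S = range (\<lambda>i. (?s ^^ i) C)"
  have S_Irr: "S \<subseteq> Defs.Irr R"
  proof -
    have "(?s ^^ i) C \<in> Defs.Irr R" for i
      using maps C by (induction i) auto
    then show ?thesis by (auto simp: S_def)
  qed
  \<comment> \<open>Exponents can be reduced modulo the period \<open>Suc t\<close>.\<close>
  have "S = (\<lambda>i. (?s ^^ i) C) ` {..<Suc t}"
  proof -
    have "(?s ^^ i) C = (?s ^^ (i mod Suc t)) C" for i
      using funpow_mod_eq[OF period, of i] by simp
    then have "(?s ^^ i) C \<in> (\<lambda>i. (?s ^^ i) C) ` {..<Suc t}" for i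
      by (intro image_eqI[of _ _ "i mod Suc t"]) simp_all
    then show ?thesis unfolding S_def by blast
  qed
  then have "finite S" by simp
  have C_S: "C \<in> S"
    unfolding S_def by (rule range_eqI[of _ _ 0]) simp
  have step: "?s D \<in> S" if D: "D \<in> S" for D
  proof -
    obtain i where "D = (?s ^^ i) C" using D by (auto simp: S_def)
    then have "?s D = (?s ^^ Suc i) C" by simp
    then show ?thesis unfolding S_def by (rule range_eqI)
  qed
  \<comment> \<open>The predecessor of the i-th iterate is the (i + t)-th, one step short of a full
    period further on.\<close>
  have pred: "\<exists>D'\<in>S. D = ?s D'" if D: "D \<in> S" for D
  proof -
    obtain i where i: "D = (?s ^^ i) C" using D by (auto simp: S_def)
    have "D = (?s ^^ i) ((?s ^^ Suc t) C)" using i period by simp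
    also have "\<dots> = (?s ^^ Suc (i + t)) C"
      by (simp only: funpow_add comp_apply flip: add_Suc_right)
    finally have "D = ?s ((?s ^^ (i + t)) C)" by simp
    then show ?thesis unfolding S_def by blast
  qed
  let ?B = "BijGroup (carrier R)" and ?G = "RingAutoGroup R"
  interpret G: group ?G by (rule group_RingAutoGroup)
  have carrG: "carrier ?G = ring_auto R" by (simp add: RingAutoGroup_def)
  \<comment> \<open>Induction over the generated subgroup; \<open>step\<close> serves the generator
    and \<open>pred\<close> its inverse.\<close>
  have "g \<in> carrier ?G \<and> (\<forall>D\<in>S. Irr_action g D \<in> S)"
    if "g \<in> generate ?G {\<tau>}" for g
    using that
  proof induction
    case one
    have one_eq: "\<one>\<^bsub>?G\<^esub> = (\<lambda>x\<in>carrier R. x)"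
      by (simp add: RingAutoGroup_def BijGroup_def)
    moreover have "(\<lambda>x\<in>carrier R. x) ` D = D" if "D \<in> S" for D
      using sub S_Irr that by (force simp: image_iff)
    ultimately have "\<forall>D\<in>S. Irr_action \<one>\<^bsub>?G\<^esub> D \<in> S"
      by (simp add: Irr_action_def)
    then show ?case using G.one_closed by blast
  next
    case (incl h)
    then show ?case using step \<tau> carrG by auto
  next
    case (inv h)
    then have h: "h = \<tau>" "\<tau> \<in> carrier ?G" using \<tau> carrG by auto
    have "inv\<^bsub>?G\<^esub> \<tau> = inv\<^bsub>?B\<^esub> \<tau>"
      using group.m_inv_consistent[OF group_BijGroup subgroup_ring_auto \<tau>]
      by (simp add: RingAutoGroup_def)
    \<comment> \<open>Group elements are extensional maps, so the inverse is \<open>inv_into\<close>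
      only on the carrier; all classes in \<open>S\<close> lie inside it.\<close>
    then have inv_eq: "inv\<^bsub>?G\<^esub> \<tau> = (\<lambda>x\<in>carrier R. inv_into (carrier R) \<tau> x)"
      using \<tau> by (simp add: inv_BijGroup ring_auto_def)
    have "Irr_action (inv\<^bsub>?G\<^esub> \<tau>) D \<in> S" if D: "D \<in> S" for D
    proof -
      obtain D' where D': "D' \<in> S" "D = \<tau> ` D'"
        using pred[OF D] by (auto simp: Irr_action_def)
      have "D' \<subseteq> carrier R" using D' S_Irr sub by auto
      have "(inv\<^bsub>?G\<^esub> \<tau>) (\<tau> x) = x" if "x \<in> D'" for x
      proof -
        have "x \<in> carrier R" using \<open>D' \<subseteq> carrier R\<close> that by (rule subsetD)
        then show ?thesis
          unfolding inv_eq using inj ring_auto_closed[OF \<tau>] by (simp add: inv_into_f_f)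
      qed
      then have "Irr_action (inv\<^bsub>?G\<^esub> \<tau>) D = D'"
        unfolding D'(2) Irr_action_def image_image by simp
      then show ?thesis using D'(1) by simp
    qed
    then show ?case using h by auto
  next
    case (eng g h)
    have gh: "g \<in> Bij (carrier R)" "h \<in> Bij (carrier R)"
      using eng carrG by (auto simp: ring_auto_def)
    have "Irr_action (g \<otimes>\<^bsub>?G\<^esub> h) D \<in> S" if D: "D \<in> S" for D
    proof -
      have "D \<subseteq> carrier R" using D S_Irr sub by auto
      then have "Irr_action (g \<otimes>\<^bsub>?G\<^esub> h) D = Irr_action g (Irr_action h D)"
        using gh by (force simp: Irr_action_def RingAutoGroup_def BijGroup_def compose_def image_iff)
      then show ?thesis using eng D by auto
    qed
    then show ?case using eng G.m_closed by auto
  qed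
  \<comment> \<open>\<open>subgroup_generated\<close> first intersects the generating set with the
    carrier.\<close>
  moreover have "carrier ?G \<inter> {\<tau>} = {\<tau>}" using \<tau> carrG by auto
  ultimately have "orbit (subgroup_generated ?G {\<tau>}) Irr_action C \<subseteq> S"
    using C_S by (auto simp: orbit_def carrier_subgroup_generated)
  then have "finite (orbit (subgroup_generated ?G {\<tau>}) Irr_action C)"
    using \<open>finite S\<close> finite_subset by blast
  moreover have "orbit (subgroup_generated ?G {\<tau>}) Irr_action C \<in> Irr_orbits R \<tau>"
    using C by (auto simp: Irr_orbits_def orbits_def)
  ultimately show False using inf by blast
qed

end

section \<open>Basis vector of a free module of rank one\<close>

lemma (in left_module) free_of_rank_one_basis:
  assumes f: "\<phi> \<in> ring_hom R A" and free: "free_of_rank R (restrict_scalars \<phi> M) 1"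
  obtains m where "m \<in> carrier M" "bij_betw (\<lambda>r. \<phi> r \<odot>\<^bsub>M\<^esub> m) (carrier R) (carrier M)"
proof -
  let ?S = "restrict_scalars \<phi> M"
  obtain B where B: "B \<subseteq> carrier ?S" "finite B" "card B = 1"
    and ex: "\<forall>v\<in>carrier ?S. \<exists>!c. c \<in> B \<rightarrow>\<^sub>E carrier R \<and> v = (\<Oplus>\<^bsub>?S\<^esub>b\<in>B. c b \<odot>\<^bsub>?S\<^esub> b)"
    using free unfolding free_of_rank_def by blast
  obtain m where Bm: "B = {m}" using B(3) by (rule card_1_singletonE)
  have carr: "carrier ?S = carrier M" by (simp add: restrict_scalars_def)
  have m: "m \<in> carrier M" using B(1) Bm carr by auto
  have cl: "\<phi> r \<odot>\<^bsub>M\<^esub> m \<in> carrier M" if "r \<in> carrier R" for r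
    using smult_closed m ring_hom_closed[OF f that] by simp
  interpret S: abelian_monoid ?S
    by (rule abelian_monoidI) (simp_all add: restrict_scalars_def M.add.m_ac)
  have sum: "(\<Oplus>\<^bsub>?S\<^esub>b\<in>B. c b \<odot>\<^bsub>?S\<^esub> b) = \<phi> (c m) \<odot>\<^bsub>M\<^esub> m" if "c m \<in> carrier R" for c
  proof -
    have "(\<Oplus>\<^bsub>?S\<^esub>b\<in>B. c b \<odot>\<^bsub>?S\<^esub> b) = c m \<odot>\<^bsub>?S\<^esub> m \<oplus>\<^bsub>?S\<^esub> \<zero>\<^bsub>?S\<^esub>"
      unfolding Bm using cl[OF that]
      by (subst S.finsum_insert, unfold S.finsum_empty) (simp_all add: restrict_scalars_def)
    also have "\<dots> = \<phi> (c m) \<odot>\<^bsub>M\<^esub> m"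
      using cl[OF that] by (simp add: restrict_scalars_def)
    finally show ?thesis .
  qed
  have "bij_betw (\<lambda>r. \<phi> r \<odot>\<^bsub>M\<^esub> m) (carrier R) (carrier M)"
    unfolding bij_betw_def
  proof
    show "inj_on (\<lambda>r. \<phi> r \<odot>\<^bsub>M\<^esub> m) (carrier R)"
    proof (rule inj_onI)
      fix r s assume rs: "r \<in> carrier R" "s \<in> carrier R" "\<phi> r \<odot>\<^bsub>M\<^esub> m = \<phi> s \<odot>\<^bsub>M\<^esub> m"
      \<comment> \<open>The scalars \<open>r\<close> and \<open>s\<close> become extensional
        coefficient families on the singleton \<open>B\<close>, which the uniqueness of coefficients
        identifies.\<close>
      let ?c = "\<lambda>r. \<lambda>b\<in>B. r"
      have "\<exists>!c. c \<in> B \<rightarrow>\<^sub>E carrier R \<and> \<phi> r \<odot>\<^bsub>M\<^esub> m = (\<Oplus>\<^bsub>?S\<^esub>b\<in>B. c b \<odot>\<^bsub>?S\<^esub> b)"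
        using ex cl[OF rs(1)] carr by blast
      moreover have "?c r \<in> B \<rightarrow>\<^sub>E carrier R" "?c s \<in> B \<rightarrow>\<^sub>E carrier R"
        using rs by auto
      moreover have "\<phi> r \<odot>\<^bsub>M\<^esub> m = (\<Oplus>\<^bsub>?S\<^esub>b\<in>B. ?c r b \<odot>\<^bsub>?S\<^esub> b)"
        using rs sum[of "?c r"] by (simp add: Bm)
      moreover have "\<phi> r \<odot>\<^bsub>M\<^esub> m = (\<Oplus>\<^bsub>?S\<^esub>b\<in>B. ?c s b \<odot>\<^bsub>?S\<^esub> b)"
        using rs sum[of "?c s"] by (simp add: Bm)
      ultimately have "?c r = ?c s" by blast
      then have "?c r m = ?c s m" by (rule fun_cong)
      then show "r = s" by (simp add: Bm)
    qed
    show "(\<lambda>r. \<phi> r \<odot>\<^bsub>M\<^esub> m) ` carrier R = carrier M"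
    proof
      show "(\<lambda>r. \<phi> r \<odot>\<^bsub>M\<^esub> m) ` carrier R \<subseteq> carrier M" using cl by blast
      show "carrier M \<subseteq> (\<lambda>r. \<phi> r \<odot>\<^bsub>M\<^esub> m) ` carrier R"
      proof
        fix v assume "v \<in> carrier M"
        then obtain c where c: "c \<in> B \<rightarrow>\<^sub>E carrier R" "v = (\<Oplus>\<^bsub>?S\<^esub>b\<in>B. c b \<odot>\<^bsub>?S\<^esub> b)"
          using ex carr by blast
        then have "c m \<in> carrier R" by (auto simp: Bm)
        then show "v \<in> (\<lambda>r. \<phi> r \<odot>\<^bsub>M\<^esub> m) ` carrier R"
          using c(2) sum[of c] by auto
      qed
    qed
  qed
  then show thesis using that m by blast
qed

section \<open>Action of x and y in coordinates\<close>

locale gwa_rank_one = principal_domain R + Mod: left_module "GWA R \<tau> a" M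
  for R (structure) and \<tau> and a and M (structure) +
  fixes m
  assumes auto: "\<tau> \<in> ring_auto R"
    and a_carrier: "a \<in> carrier (mult_of R)"
    and m_carrier: "m \<in> carrier M"
    and basis: "bij_betw (\<lambda>r. gwa_of R \<tau> a r \<odot>\<^bsub>M\<^esub> m) (carrier R) (carrier M)"
begin

abbreviation "genx \<equiv> gwa_class R \<tau> a GenX"
abbreviation "geny \<equiv> gwa_class R \<tau> a GenY"

definition vec :: "'a \<Rightarrow> 'c"
  where "vec r = gwa_of R \<tau> a r \<odot>\<^bsub>M\<^esub> m"

definition coord :: "'c \<Rightarrow> 'a"
  where "coord v = inv_into (carrier R) vec v"

lemma vec_bij: "bij_betw vec (carrier R) (carrier M)"
  using basis by (simp add: vec_def[abs_def])

lemma vec_closed: "r \<in> carrier R \<Longrightarrow> vec r \<in> carrier M"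
  using vec_bij by (rule bij_betwE[THEN bspec])

lemma vec_inj: "vec r = vec s \<Longrightarrow> r \<in> carrier R \<Longrightarrow> s \<in> carrier R \<Longrightarrow> r = s"
  using vec_bij by (auto simp: bij_betw_def dest: inj_onD)

lemma coord_closed: "v \<in> carrier M \<Longrightarrow> coord v \<in> carrier R"
  unfolding coord_def using vec_bij by (auto simp: bij_betw_def intro: inv_into_into)

lemma vec_coord: "v \<in> carrier M \<Longrightarrow> vec (coord v) = v"
  unfolding coord_def by (rule bij_betw_inv_into_right[OF vec_bij])

lemma gwa_of_closed: "r \<in> carrier R \<Longrightarrow> gwa_of R \<tau> a r \<in> carrier (GWA R \<tau> a)"
  by (rule ring_hom_closed[OF gwa_of_hom])

lemma gens_closed: "genx \<in> carrier (GWA R \<tau> a)" "geny \<in> carrier (GWA R \<tau> a)"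
  by (simp_all add: GWA_carrierI)

lemma vec_add:
  assumes "r \<in> carrier R" "s \<in> carrier R"
  shows "vec (r \<oplus> s) = vec r \<oplus>\<^bsub>M\<^esub> vec s"
  unfolding vec_def ring_hom_add[OF gwa_of_hom assms]
  using assms gwa_of_closed m_carrier by (simp add: Mod.smult_l_distr)

lemma smult_vec:
  assumes "r \<in> carrier R" "s \<in> carrier R"
  shows "gwa_of R \<tau> a r \<odot>\<^bsub>M\<^esub> vec s = vec (r \<otimes> s)"
  unfolding vec_def ring_hom_mult[OF gwa_of_hom assms]
  using assms gwa_of_closed m_carrier by (simp add: Mod.smult_assoc)

lemma vec_zero: "vec \<zero> = \<zero>\<^bsub>M\<^esub>"
proof -
  have "vec \<zero> \<oplus>\<^bsub>M\<^esub> vec \<zero> = vec \<zero>"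
    using vec_add[of \<zero> \<zero>] by simp
  then show ?thesis
    using vec_closed[of \<zero>] by (metis Mod.M.add.l_cancel_one' zero_closed)
qed

text \<open>\<open>xcoord\<close> and \<open>ycoord\<close> are the p and q of the overview; they
  determine the whole module structure.\<close>

definition xcoord :: 'a where "xcoord = coord (genx \<odot>\<^bsub>M\<^esub> m)"
definition ycoord :: 'a where "ycoord = coord (geny \<odot>\<^bsub>M\<^esub> m)"

lemma xcoord: "xcoord \<in> carrier R" "vec xcoord = genx \<odot>\<^bsub>M\<^esub> m"
  and ycoord: "ycoord \<in> carrier R" "vec ycoord = geny \<odot>\<^bsub>M\<^esub> m"
  unfolding xcoord_def ycoord_def
  using Mod.smult_closed[OF gens_closed(1) m_carrier] Mod.smult_closed[OF gens_closed(2) m_carrier]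
  by (simp_all add: coord_closed vec_coord)

text \<open>From x sigma(r) = r x. Since x acts semilinearly for the inverse automorphism, the
  argument is written as \<open>\<tau> r\<close> to avoid that inverse.\<close>

lemma genx_vec:
  assumes r: "r \<in> carrier R"
  shows "genx \<odot>\<^bsub>M\<^esub> vec (\<tau> r) = vec (r \<otimes> xcoord)"
proof -
  have \<tau>r: "\<tau> r \<in> carrier R" by (rule ring_auto_closed[OF auto r])
  have "genx \<odot>\<^bsub>M\<^esub> vec (\<tau> r) = (genx \<otimes>\<^bsub>GWA R \<tau> a\<^esub> gwa_of R \<tau> a (\<tau> r)) \<odot>\<^bsub>M\<^esub> m"
    unfolding vec_def by (simp add: Mod.smult_assoc gens_closed gwa_of_closed[OF \<tau>r] m_carrier)
  also have "\<dots> = (gwa_of R \<tau> a r \<otimes>\<^bsub>GWA R \<tau> a\<^esub> genx) \<odot>\<^bsub>M\<^esub> m"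
    using GWA_relations(1)[OF auto _ r, of a] a_carrier by simp
  also have "\<dots> = gwa_of R \<tau> a r \<odot>\<^bsub>M\<^esub> vec xcoord"
    unfolding xcoord(2) by (simp add: Mod.smult_assoc gens_closed gwa_of_closed[OF r] m_carrier)
  also have "\<dots> = vec (r \<otimes> xcoord)"
    by (rule smult_vec[OF r xcoord(1)])
  finally show ?thesis .
qed

lemma geny_vec:
  assumes r: "r \<in> carrier R"
  shows "geny \<odot>\<^bsub>M\<^esub> vec r = vec (\<tau> r \<otimes> ycoord)"
proof -
  have \<tau>r: "\<tau> r \<in> carrier R" by (rule ring_auto_closed[OF auto r])
  have "geny \<odot>\<^bsub>M\<^esub> vec r = (geny \<otimes>\<^bsub>GWA R \<tau> a\<^esub> gwa_of R \<tau> a r) \<odot>\<^bsub>M\<^esub> m"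
    unfolding vec_def by (simp add: Mod.smult_assoc gens_closed gwa_of_closed[OF r] m_carrier)
  also have "\<dots> = (gwa_of R \<tau> a (\<tau> r) \<otimes>\<^bsub>GWA R \<tau> a\<^esub> geny) \<odot>\<^bsub>M\<^esub> m"
    using GWA_relations(2)[OF auto _ r, of a] a_carrier by simp
  also have "\<dots> = gwa_of R \<tau> a (\<tau> r) \<odot>\<^bsub>M\<^esub> vec ycoord"
    unfolding ycoord(2) by (simp add: Mod.smult_assoc gens_closed gwa_of_closed[OF \<tau>r] m_carrier)
  also have "\<dots> = vec (\<tau> r \<otimes> ycoord)"
    by (rule smult_vec[OF \<tau>r ycoord(1)])
  finally show ?thesis .
qed

lemma ring_auto_preimage:
  assumes "r \<in> carrier R"
  obtains s where "s \<in> carrier R" "r = \<tau> s"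
  using ring_auto_bij[OF auto] assms by (auto simp: bij_betw_def)

text \<open>Write q = sigma(q'). Then xy = a applied to the basis gives q' p = a, and applying sigma
  yields the claim. It splits the factors of sigma(a) between sigma(p) and q.\<close>

lemma coord_mult: "\<tau> xcoord \<otimes> ycoord = \<tau> a"
proof -
  obtain q where q: "q \<in> carrier R" "ycoord = \<tau> q"
    using ycoord(1) by (rule ring_auto_preimage)
  have aR: "a \<in> carrier R" using a_carrier by simp
  have "vec (q \<otimes> xcoord) = genx \<odot>\<^bsub>M\<^esub> (geny \<odot>\<^bsub>M\<^esub> m)"
    unfolding genx_vec[OF q(1), symmetric] q(2)[symmetric] ycoord(2) ..
  also have "\<dots> = (genx \<otimes>\<^bsub>GWA R \<tau> a\<^esub> geny) \<odot>\<^bsub>M\<^esub> m"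
    by (simp add: Mod.smult_assoc gens_closed m_carrier)
  also have "\<dots> = vec a"
    unfolding vec_def using GWA_relations(3)[OF auto aR aR] by simp
  finally have "q \<otimes> xcoord = a"
    using vec_inj q(1) xcoord(1) aR by simp
  then have "\<tau> q \<otimes> \<tau> xcoord = \<tau> a"
    using ring_hom_mult[OF ring_auto_hom[OF auto] q(1) xcoord(1)] by simp
  then show ?thesis
    using q ring_auto_closed[OF auto xcoord(1)] ycoord(1) by (simp add: m_comm)
qed

lemma coord_nonzero: "\<tau> xcoord \<in> carrier (mult_of R)" "ycoord \<in> carrier (mult_of R)"
proof -
  have "\<tau> xcoord \<otimes> ycoord \<noteq> \<zero>"
    unfolding coord_mult using ring_auto_nonzero[OF auto a_carrier] by simp
  then show "\<tau> xcoord \<in> carrier (mult_of R)" "ycoord \<in> carrier (mult_of R)"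
    using ring_auto_closed[OF auto xcoord(1)] ycoord(1) by auto
qed

section \<open>Submodules as principal ideals\<close>

definition coord_ideal :: "'c set \<Rightarrow> 'a set"
  where "coord_ideal N = {r \<in> carrier R. vec r \<in> N}"

lemma submodule_smult:
  "submodule N (GWA R \<tau> a) M \<Longrightarrow> c \<in> carrier (GWA R \<tau> a) \<Longrightarrow> v \<in> N \<Longrightarrow> c \<odot>\<^bsub>M\<^esub> v \<in> N"
  by (rule submodule.smult_closed)

lemma submodule_subset: "submodule N (GWA R \<tau> a) M \<Longrightarrow> N \<subseteq> carrier M"
  using subgroup.subset[OF submodule.axioms(1)] by fastforce

lemma submodule_zero: "submodule N (GWA R \<tau> a) M \<Longrightarrow> \<zero>\<^bsub>M\<^esub> \<in> N"
  using subgroup.one_closed[OF submodule.axioms(1)] by fastforce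

lemma ideal_coord_ideal:
  assumes N: "submodule N (GWA R \<tau> a) M"
  shows "ideal (coord_ideal N) R"
proof -
  have mult: "r \<otimes> s \<in> coord_ideal N" if "r \<in> carrier R" "s \<in> coord_ideal N" for r s
  proof -
    have s: "s \<in> carrier R" "vec s \<in> N" using that(2) by (simp_all add: coord_ideal_def)
    have "vec (r \<otimes> s) \<in> N"
      unfolding smult_vec[OF that(1) s(1), symmetric]
      by (rule submodule_smult[OF N gwa_of_closed[OF that(1)] s(2)])
    then show ?thesis using that(1) s(1) by (simp add: coord_ideal_def)
  qed
  show ?thesis
  proof (rule idealI[OF ring_axioms])
    show "subgroup (coord_ideal N) (add_monoid R)"
    proof (rule add.subgroupI)
      show "coord_ideal N \<subseteq> carrier R" by (auto simp: coord_ideal_def)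
      have "\<zero> \<in> coord_ideal N"
        using submodule_zero[OF N] by (simp add: coord_ideal_def vec_zero)
      then show "coord_ideal N \<noteq> {}" by blast
      fix r assume r: "r \<in> coord_ideal N"
      then have rR: "r \<in> carrier R" by (simp add: coord_ideal_def)
      have "(\<ominus> \<one>) \<otimes> r = \<ominus> r" using rR by (simp add: l_minus)
      then show "\<ominus> r \<in> coord_ideal N" using mult[of "\<ominus> \<one>" r] r by simp
      fix s assume s: "s \<in> coord_ideal N"
      have "vec r \<oplus>\<^bsub>M\<^esub> vec s \<in> N"
        using subgroup.m_closed[OF submodule.axioms(1)[OF N]] r s by (simp add: coord_ideal_def)
      then show "r \<oplus> s \<in> coord_ideal N"
        using r s by (simp add: coord_ideal_def vec_add)
    qed
  next
    fix r s assume "r \<in> coord_ideal N" "s \<in> carrier R"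
    then show "s \<otimes> r \<in> coord_ideal N" by (intro mult)
    then show "r \<otimes> s \<in> coord_ideal N"
      using \<open>r \<in> coord_ideal N\<close> \<open>s \<in> carrier R\<close> by (simp add: coord_ideal_def m_comm)
  qed
qed

definition gen :: "'c set \<Rightarrow> 'a"
  where "gen N = (SOME f. f \<in> carrier R \<and> coord_ideal N = PIdl f)"

lemma gen:
  assumes "submodule N (GWA R \<tau> a) M"
  shows "gen N \<in> carrier R" "coord_ideal N = PIdl (gen N)"
proof -
  have "\<exists>f. f \<in> carrier R \<and> coord_ideal N = PIdl f"
    using exists_gen[OF ideal_coord_ideal[OF assms]] by blast
  then have "gen N \<in> carrier R \<and> coord_ideal N = PIdl (gen N)"
    unfolding gen_def by (rule someI_ex)
  then show "gen N \<in> carrier R" "coord_ideal N = PIdl (gen N)" by simp_all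
qed

lemma vec_mem_submodule_iff:
  assumes "submodule N (GWA R \<tau> a) M" "r \<in> carrier R"
  shows "vec r \<in> N \<longleftrightarrow> gen N divides r"
proof -
  have "vec r \<in> N \<longleftrightarrow> r \<in> PIdl (gen N)"
    using assms(2) gen(2)[OF assms(1)] by (auto simp: coord_ideal_def)
  also have "\<dots> \<longleftrightarrow> gen N divides r"
    using gen(1)[OF assms(1)] m_comm by (auto simp: cgenideal_def factor_def)
  finally show ?thesis .
qed

lemma vec_gen_mem:
  assumes "submodule N (GWA R \<tau> a) M"
  shows "vec (gen N) \<in> N"
  using vec_mem_submodule_iff[OF assms gen(1)[OF assms]] gen(1)[OF assms] by simp

lemma gen_nonzero:
  assumes N: "submodule N (GWA R \<tau> a) M" and "N \<noteq> {\<zero>\<^bsub>M\<^esub>}"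
  shows "gen N \<in> carrier (mult_of R)"
proof -
  obtain v where v: "v \<in> N" "v \<noteq> \<zero>\<^bsub>M\<^esub>"
    using submodule_zero[OF N] \<open>N \<noteq> {\<zero>\<^bsub>M\<^esub>}\<close> by blast
  have vM: "v \<in> carrier M" using submodule_subset[OF N] v(1) by (rule subsetD)
  have "gen N divides coord v"
    using vec_mem_submodule_iff[OF N coord_closed[OF vM]] v(1) by (simp add: vec_coord[OF vM])
  moreover have "coord v \<noteq> \<zero>"
    using vec_coord[OF vM] v(2) vec_zero by auto
  ultimately have "gen N \<noteq> \<zero>" by (auto simp: zero_divides)
  then show ?thesis using gen(1)[OF N] by simp
qed

lemma gen_divides_geny:
  assumes N: "submodule N (GWA R \<tau> a) M"
  shows "gen N divides \<tau> (gen N) \<otimes> ycoord"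
proof -
  have "vec (\<tau> (gen N) \<otimes> ycoord) \<in> N"
    unfolding geny_vec[OF gen(1)[OF N], symmetric]
    by (rule submodule_smult[OF N gens_closed(2) vec_gen_mem[OF N]])
  then show ?thesis
    using vec_mem_submodule_iff[OF N] ring_auto_closed[OF auto gen(1)[OF N]] ycoord(1) by simp
qed

text \<open>With f = sigma(g), the element x f m = g p m lies in \<open>N\<close>, so f divides g p;
  applying sigma removes the auxiliary g.\<close>

lemma gen_divides_genx:
  assumes N: "submodule N (GWA R \<tau> a) M"
  shows "\<tau> (gen N) divides gen N \<otimes> \<tau> xcoord"
proof -
  obtain g where g: "g \<in> carrier R" "gen N = \<tau> g"
    using gen(1)[OF N] by (rule ring_auto_preimage)
  have "vec (g \<otimes> xcoord) \<in> N"
    unfolding genx_vec[OF g(1), symmetric] g(2)[symmetric]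
    by (rule submodule_smult[OF N gens_closed(1) vec_gen_mem[OF N]])
  then have "gen N divides g \<otimes> xcoord"
    using vec_mem_submodule_iff[OF N] g(1) xcoord(1) by simp
  then have "\<tau> (gen N) divides \<tau> (g \<otimes> xcoord)"
    using ring_auto_divides[OF auto gen(1)[OF N]] g(1) xcoord(1) by simp
  then show ?thesis
    unfolding ring_hom_mult[OF ring_auto_hom[OF auto] g(1) xcoord(1)] g(2)[symmetric] .
qed

text \<open>A larger submodule has a generator dividing that of the smaller one; divisibility in
  both directions would force \<open>N' \<subseteq> N\<close>.\<close>

lemma factor_mset_gen_psubset:
  assumes N: "submodule N (GWA R \<tau> a) M" and N': "submodule N' (GWA R \<tau> a) M"
    and "N \<subset> N'" "N \<noteq> {\<zero>\<^bsub>M\<^esub>}"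
  shows "factor_mset (gen N') \<subset># factor_mset (gen N)"
proof -
  have "N' \<noteq> {\<zero>\<^bsub>M\<^esub>}" using assms(3,4) submodule_zero[OF N] by blast
  have g: "gen N \<in> carrier (mult_of R)" "gen N' \<in> carrier (mult_of R)"
    using gen_nonzero[OF N \<open>N \<noteq> {\<zero>\<^bsub>M\<^esub>}\<close>] gen_nonzero[OF N' \<open>N' \<noteq> {\<zero>\<^bsub>M\<^esub>}\<close>] by blast+
  have "gen N' divides gen N"
    using vec_mem_submodule_iff[OF N' gen(1)[OF N]] vec_gen_mem[OF N] \<open>N \<subset> N'\<close> by blast
  moreover have "\<not> gen N divides gen N'"
  proof
    assume d: "gen N divides gen N'"
    have "N' \<subseteq> N"
    proof
      fix v assume v: "v \<in> N'"
      then have vM: "v \<in> carrier M" using submodule_subset[OF N'] by blast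
      have "gen N' divides coord v"
        using vec_mem_submodule_iff[OF N' coord_closed[OF vM]] v by (simp add: vec_coord[OF vM])
      then have "gen N divides coord v"
        by (rule divides_trans[OF d _ gen(1)[OF N]])
      then show "v \<in> N"
        using vec_mem_submodule_iff[OF N coord_closed[OF vM]] by (simp add: vec_coord[OF vM])
    qed
    then show False using \<open>N \<subset> N'\<close> by blast
  qed
  ultimately show ?thesis
    using divides_iff_factor_mset g by (simp add: subset_mset.less_le_not_le)
qed

section \<open>Bounding chains of submodules\<close>

text \<open>Only \<open>N 0\<close> can be the zero submodule, which has no factor multiset to
  count. Shifting the index by one discards it and accounts for the summand 1.\<close>

lemma submodule_chain_le:
  assumes inf: "\<forall>orb\<in>Irr_orbits R \<tau>. infinite orb"
    and N: "\<forall>i\<le>n. submodule (N i) (GWA R \<tau> a) M" and chain: "\<forall>i<n. N i \<subset> N (Suc i)"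
  shows "n \<le> 1 + size (factor_mset (\<tau> xcoord)) * size (factor_mset ycoord)"
proof (cases n)
  case (Suc k)
  define F where "F i = factor_mset (gen (N (Suc i)))" for i
  let ?s = "Irr_action \<tau>"
  have sub: "submodule (N (Suc i)) (GWA R \<tau> a) M" if "i \<le> k" for i
    using N that Suc by simp
  \<comment> \<open>Each of these strictly contains a submodule that already contains zero.\<close>
  have nz: "N (Suc i) \<noteq> {\<zero>\<^bsub>M\<^esub>}" if "i \<le> k" for i
  proof -
    have "N i \<subset> N (Suc i)" and Ni: "submodule (N i) (GWA R \<tau> a) M"
      using N chain that Suc by simp_all
    then show ?thesis using submodule_zero[OF Ni] by (auto simp: psubset_eq)
  qed
  have g: "gen (N (Suc i)) \<in> carrier (mult_of R)" if "i \<le> k" for i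
    by (rule gen_nonzero[OF sub[OF that] nz[OF that]])
  have "k \<le> size (factor_mset (\<tau> xcoord)) * size (factor_mset ycoord)"
  proof (rule chain_length_le[OF iterates_freely_Irr_action[OF auto inf]])
    show "set_mset (factor_mset (\<tau> xcoord)) \<subseteq> Defs.Irr R"
      "set_mset (factor_mset ycoord) \<subseteq> Defs.Irr R"
      by (rule set_factor_mset, rule coord_nonzero)+
    fix i assume i: "i \<le> k"
    note gi = g[OF i] and tg = ring_auto_nonzero[OF auto g[OF i]]
    show "set_mset (F i) \<subseteq> Defs.Irr R"
      unfolding F_def by (rule set_factor_mset[OF gi])
    have "factor_mset (\<tau> (gen (N (Suc i)))) \<subseteq># factor_mset (gen (N (Suc i)) \<otimes> \<tau> xcoord)"
      using gen_divides_genx[OF sub[OF i]]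
        divides_iff_factor_mset[OF tg mult_of.m_closed[OF gi coord_nonzero(1)]] by blast
    then show "image_mset ?s (F i) \<subseteq># factor_mset (\<tau> xcoord) + F i"
      unfolding F_def factor_mset_ring_auto[OF auto gi] factor_mset_mult[OF gi coord_nonzero(1)]
      by (simp only: add.commute)
    have "factor_mset (gen (N (Suc i))) \<subseteq># factor_mset (\<tau> (gen (N (Suc i))) \<otimes> ycoord)"
      using gen_divides_geny[OF sub[OF i]]
        divides_iff_factor_mset[OF gi mult_of.m_closed[OF tg coord_nonzero(2)]] by blast
    then show "F i \<subseteq># factor_mset ycoord + image_mset ?s (F i)"
      unfolding F_def factor_mset_mult[OF tg coord_nonzero(2)] factor_mset_ring_auto[OF auto gi]
      by (simp only: add.commute)
  next
    fix i assume i: "i < k"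
    show "F (Suc i) \<subset># F i"
      unfolding F_def
      using factor_mset_gen_psubset[OF sub[of i] sub[of "Suc i"] _ nz[of i]] chain i Suc by simp
  qed
  then show ?thesis using Suc by simp
qed simp

text \<open>Sizes add over the product sigma(p) q = sigma(a), and the automorphism preserves the
  number of irreducible factors.\<close>

lemma size_factor_mset_coords:
  "size (factor_mset (\<tau> xcoord)) + size (factor_mset ycoord) = factorcount (mult_of R) a"
proof -
  have "size (factor_mset (\<tau> xcoord)) + size (factor_mset ycoord) = size (factor_mset (\<tau> a))"
    unfolding coord_mult[symmetric] factor_mset_mult[OF coord_nonzero] by simp
  then show ?thesis
    by (simp add: factor_mset_ring_auto[OF auto a_carrier] size_factor_mset[OF a_carrier])
qed

lemma module_length_le:
  assumes "\<forall>orb\<in>Irr_orbits R \<tau>. infinite orb"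
  shows "module_length (GWA R \<tau> a) M
    \<le> enat (1 + size (factor_mset (\<tau> xcoord)) * size (factor_mset ycoord))"
  unfolding module_length_def
proof (rule Sup_least)
  fix l assume "l \<in> {enat n | n. \<exists>N. (\<forall>i\<le>n. submodule (N i) (GWA R \<tau> a) M) \<and> (\<forall>i<n. N i \<subset> N (Suc i))}"
  then obtain n N where "l = enat n" "\<forall>i\<le>n. submodule (N i) (GWA R \<tau> a) M" "\<forall>i<n. N i \<subset> N (Suc i)"
    by blast
  then show "l \<le> enat (1 + size (factor_mset (\<tau> xcoord)) * size (factor_mset ycoord))"
    using submodule_chain_le[OF assms] by simp
qed

end

section \<open>The length bound in terms of the degree\<close>

theorem corollary3p11:
  fixes R :: "'r ring" and \<sigma> :: "'r \<Rightarrow> 'r" and a :: 'r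
    and M :: "('r gwa_term set, 'm) module"
  assumes "principal_domain R"
    and "\<sigma> \<in> ring_auto R"
    and "a \<in> carrier R" and "a \<noteq> \<zero>\<^bsub>R\<^esub>"
    and "\<forall>orb \<in> Irr_orbits R \<sigma>. infinite orb"
    and "left_module (GWA R \<sigma> a) M"
    and "free_of_rank R (restrict_scalars (gwa_of R \<sigma> a) M) 1"
  shows "finite_length (GWA R \<sigma> a) M \<and>
    real (the_enat (module_length (GWA R \<sigma> a) M))
      \<le> 1 + (real (factorcount (mult_of R) a) / 2)\<^sup>2"
proof -
  interpret R: principal_domain R by fact
  obtain m where m: "m \<in> carrier M"
    "bij_betw (\<lambda>r. gwa_of R \<sigma> a r \<odot>\<^bsub>M\<^esub> m) (carrier R) (carrier M)"
    using left_module.free_of_rank_one_basis[OF assms(6) R.gwa_of_hom assms(7)] .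
  interpret gwa_rank_one R \<sigma> a M m
    using assms(1-6) m by (intro gwa_rank_one.intro gwa_rank_one_axioms.intro) simp_all
  define p where "p = size (R.factor_mset (\<sigma> xcoord))"
  define q where "q = size (R.factor_mset ycoord)"
  have le: "module_length (GWA R \<sigma> a) M \<le> enat (1 + p * q)"
    unfolding p_def q_def by (rule module_length_le[OF assms(5)])
  \<comment> \<open>A finite upper bound excludes the value infinity, so \<open>the_enat\<close>
    returns the actual length \<open>l\<close>.\<close>
  then obtain l where l: "module_length (GWA R \<sigma> a) M = enat l" "l \<le> 1 + p * q"
    by (cases "module_length (GWA R \<sigma> a) M") auto
  have "real l \<le> 1 + real p * real q"
    using l(2) by (metis of_nat_1 of_nat_add of_nat_le_iff of_nat_mult)
  \<comment> \<open>The inequality of arithmetic and geometric means, obtained from the nonnegative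
    square of p - q.\<close>
  also have "\<dots> \<le> 1 + ((real p + real q) / 2)\<^sup>2"
    using zero_le_power2[of "real p - real q"] by (simp add: power2_eq_square algebra_simps)
  also have "real p + real q = real (factorcount (mult_of R) a)"
    using size_factor_mset_coords unfolding p_def q_def by (metis of_nat_add)
  finally show ?thesis
    using l(1) by (simp add: finite_length_def)
qed

end
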